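(* Let $\{\tilde u^n\}_{n=0}^N$ and $\{\tilde v^n\}_{n=0}^N$ be grid functions in $\mathcal{V}_h$ satisfying the perturbed equations $$\mathcal{A}D_N^{\alpha}\tilde u_i^n=-\delta_x^2\tilde v_i^n+q\,\mathcal{A}\tilde u_i^n+\xi_i^n+\zeta_i^n,\quad 1\le i\le M-1,\ 1\le n\le N,$$ $$\mathcal{A}\tilde v_i^n=\delta_x^2\tilde u_i^n+\eta_i^n,\quad 0\le i\le M,\ 0\le n\le N,$$ with $\tilde u_0^n=\tilde u_M^n=0$ for $1\le n\le N$, where $\xi^n,\zeta^n,\eta^n\in\mathcal{V}_h$ are given. If the maximum time-step size satisfies $\tau\le 1/\sqrt[\alpha]{4\Gamma(2-\alpha)q_+}$, then for $1\le n\le N$ $$\|\mathcal{A}\tilde u^n\|\le 2E_\alpha\big(4q_+\max\{1,\rho\}t_n^\alpha\big)\Big(\|\mathcal{A}\tilde u^0\|+2\max_{1\le k\le n}\sum_{j=1}^k p_{k-j}^{(k)}\|\zeta^j\|+2\Gamma(1-\alpha)\max_{1\le k\le n}\{t_k^\alpha\|\xi^k\|\}+\sqrt{\Gamma(1-\alpha)}\max_{1\le k\le n}\{t_k^{\alpha/2}\|\eta^k\|\}\Big).$$ In this sense the compact difference scheme of which these are the perturbation equations is stable in the discrete $L^2$ norm.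
   Context: Fix $0<\alpha<1$, $L,T>0$ and a real constant $q$; $q_+:=\max\{q,0\}$ (if $q_+=0$ the restriction on $\tau$ is void). Time mesh: $0=t_0<t_1<\dots<t_N=T$, $\tau_k:=t_k-t_{k-1}$, $\tau:=\max_{1\le k\le N}\tau_k$, step ratios $\rho_k:=\tau_k/\tau_{k+1}$ for $1\le k\le N-1$; $\rho>0$ is a constant with $\rho_k\le\rho$ for all $1\le k\le N-1$. For a sequence $(w^k)$, $\nabla_\tau w^k:=w^k-w^{k-1}$. With $\omega_\beta(t):=t^{\beta-1}/\Gamma(\beta)$ for $t>0$, the nonuniform L1 formula is $D_N^\alpha w^n:=\sum_{k=1}^n a_{n-k}^{(n)}\nabla_\tau w^k$, where $a_{n-k}^{(n)}:=\frac1{\tau_k}\int_{t_{k-1}}^{t_k}\omega_{1-\alpha}(t_n-s)\,ds$ for $1\le k\le n$. The complementary kernels are defined by $p_0^{(n)}:=1/a_0^{(n)}$ and $p_{n-j}^{(n)}:=\frac1{a_0^{(j)}}\sum_{k=j+1}^n\big(a_{k-j-1}^{(k)}-a_{k-j}^{(k)}\big)p_{n-k}^{(n)}$ for $1\le j\le n-1$. $E_\alpha(z):=\sum_{k=0}^\infty z^k/\Gamma(1+k\alpha)$. Space mesh: $M$ a positive integer, $h:=L/M$, $x_i:=ih$ for $0\le i\le M$; $\mathcal{V}_h$ is the space of grid functions $v=(v_0,\dots,v_M)$. Put $\delta_xv_{i-1/2}:=(v_i-v_{i-1})/h$; $\delta_x^2v_0:=\frac2h\delta_xv_{1/2}$,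 $\delta_x^2v_i:=\frac1h(\delta_xv_{i+1/2}-\delta_xv_{i-1/2})$ for $1\le i\le M-1$, $\delta_x^2v_M:=-\frac2h\delta_xv_{M-1/2}$. The averaging operator is $\mathcal{A}v_0:=\frac23v_0+\frac13v_1$, $\mathcal{A}v_i:=\frac1{12}(v_{i-1}+10v_i+v_{i+1})$ for $1\le i\le M-1$, $\mathcal{A}v_M:=\frac23v_M+\frac13v_{M-1}$. The discrete inner product is $\langle v,w\rangle:=\frac h2v_0w_0+h\sum_{i=1}^{M-1}v_iw_i+\frac h2v_Mw_M$ and $\|v\|:=\sqrt{\langle v,v\rangle}$. The underlying scheme (for $\partial_t^\alpha u+\partial_x^4u=qu+f$ on $(0,L)\times(0,T]$ with prescribed $u$ and $u_x$ at $x=0,L$) consists of $\mathcal{A}D_N^\alpha u_i^n=-\delta_x^2v_i^n+q\mathcal{A}u_i^n+\mathcal{A}f_i^n$ for $1\le i\le M-1$, $1\le n\le N$; $\mathcal{A}v_i^n=\delta_x^2u_i^n+g_i^n$ for $0\le i\le M$, $0\le n\le N$, where $g_i^n=0$ for $1\le i\le M-1$ and $g_0^n,g_M^n$ are determined by the given data; and prescribed values of $u_0^n,u_M^n$ for $1\le n\le N$ and of $u^0$. The differences $\tilde u,\tilde v$ between a solution of this scheme and a solution of the same scheme with extra forcing terms in the two families of equations satisfy the perturbed equations of the claim. *)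

theory Defs
  imports "HOL-Analysis.Analysis"
begin

section \<open>Nonuniform L1 formula\<close>

text \<open>A time mesh is a function \<open>t :: nat \<Rightarrow> real\<close>, of which only \<open>t 0, \<dots>, t N\<close> matter;
  a sequence in time is a function on \<open>nat\<close>.\<close>

definition tstep :: "(nat \<Rightarrow> real) \<Rightarrow> nat \<Rightarrow> real" where
  "tstep t k = t k - t (k - 1)"

definition omega :: "real \<Rightarrow> real \<Rightarrow> real" where
  "omega \<beta> s = s powr (\<beta> - 1) / Gamma \<beta>"

text \<open>\<open>L1_kernel \<alpha> t n m\<close> is $a_m^{(n)}$, the lower index being $m = n - k$. For \<open>k = n\<close> the integrand is
  singular at the right end point, where \<open>omega\<close> takes the harmless value \<open>0\<close>.\<close>

definition L1_kernel :: "real \<Rightarrow> (nat \<Rightarrow> real) \<Rightarrow> nat \<Rightarrow> nat \<Rightarrow> real" where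
  "L1_kernel \<alpha> t n m =
     (let k = n - m in
      1 / tstep t k * integral {t (k - 1)..t k} (\<lambda>s. omega (1 - \<alpha>) (t n - s)))"

definition L1_deriv :: "real \<Rightarrow> (nat \<Rightarrow> real) \<Rightarrow> (nat \<Rightarrow> real) \<Rightarrow> nat \<Rightarrow> real" where
  "L1_deriv \<alpha> t w n = (\<Sum>k = 1..n. L1_kernel \<alpha> t n (n - k) * (w k - w (k - 1)))"

text \<open>\<open>compl_kernel \<alpha> t n m\<close> is $p_m^{(n)}$, with $m = n - j$; it is meaningful for \<open>m < n\<close>.\<close>

fun compl_kernel :: "real \<Rightarrow> (nat \<Rightarrow> real) \<Rightarrow> nat \<Rightarrow> nat \<Rightarrow> real" where
  "compl_kernel \<alpha> t n m =
     (if m = 0 then 1 / L1_kernel \<alpha> t n 0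
      else let j = n - m in
        1 / L1_kernel \<alpha> t j 0 *
          (\<Sum>k = j + 1..n.
             (L1_kernel \<alpha> t k (k - j - 1) - L1_kernel \<alpha> t k (k - j)) * compl_kernel \<alpha> t n (n - k)))"

declare compl_kernel.simps [simp del]

definition mittag_leffler :: "real \<Rightarrow> real \<Rightarrow> real" where
  "mittag_leffler \<alpha> z = (\<Sum>k. z ^ k / Gamma (1 + real k * \<alpha>))"


section \<open>Spatial grid functions\<close>

text \<open>A grid function $(v_0,\dots,v_M)$ is a function \<open>v :: nat \<Rightarrow> real\<close> of which only the values at
  \<open>0, \<dots>, M\<close> matter. A time-dependent grid function is written \<open>u n i\<close> for $u_i^n$.\<close>

text \<open>\<open>dx h v i\<close> is $\delta_x v_{i-1/2}$.\<close>

definition dx :: "real \<Rightarrow> (nat \<Rightarrow> real) \<Rightarrow> nat \<Rightarrow> real" where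
  "dx h v i = (v i - v (i - 1)) / h"

definition dxx :: "real \<Rightarrow> nat \<Rightarrow> (nat \<Rightarrow> real) \<Rightarrow> nat \<Rightarrow> real" where
  "dxx h M v i =
     (if i = 0 then 2 / h * dx h v 1
      else if i = M then - (2 / h) * dx h v M
      else 1 / h * (dx h v (i + 1) - dx h v i))"

definition avg :: "nat \<Rightarrow> (nat \<Rightarrow> real) \<Rightarrow> nat \<Rightarrow> real" where
  "avg M v i =
     (if i = 0 then 2 / 3 * v 0 + 1 / 3 * v 1
      else if i = M then 2 / 3 * v M + 1 / 3 * v (M - 1)
      else 1 / 12 * (v (i - 1) + 10 * v i + v (i + 1)))"

definition grid_inner :: "real \<Rightarrow> nat \<Rightarrow> (nat \<Rightarrow> real) \<Rightarrow> (nat \<Rightarrow> real) \<Rightarrow> real" where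
  "grid_inner h M v w =
     h / 2 * v 0 * w 0 + h * (\<Sum>i = 1..M - 1. v i * w i) + h / 2 * v M * w M"

definition grid_norm :: "real \<Rightarrow> nat \<Rightarrow> (nat \<Rightarrow> real) \<Rightarrow> real" where
  "grid_norm h M v = sqrt (grid_inner h M v v)"


section \<open>The compact scheme\<close>

text \<open>\<open>r\<close> and \<open>s\<close> are extra forcing terms in the two families of equations; the scheme itself is the
  case \<open>r = s = 0\<close>. The data are the source \<open>f\<close>, the boundary contributions \<open>g\<close>, the boundary values
  \<open>bl\<close>, \<open>br\<close> and the initial value \<open>\<phi>\<close>.\<close>

definition compact_scheme ::
  "real \<Rightarrow> real \<Rightarrow> real \<Rightarrow> nat \<Rightarrow> nat \<Rightarrow> (nat \<Rightarrow> real) \<Rightarrow>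
   (nat \<Rightarrow> nat \<Rightarrow> real) \<Rightarrow> (nat \<Rightarrow> nat \<Rightarrow> real) \<Rightarrow> (nat \<Rightarrow> real) \<Rightarrow> (nat \<Rightarrow> real) \<Rightarrow> (nat \<Rightarrow> real) \<Rightarrow>
   (nat \<Rightarrow> nat \<Rightarrow> real) \<Rightarrow> (nat \<Rightarrow> nat \<Rightarrow> real) \<Rightarrow>
   (nat \<Rightarrow> nat \<Rightarrow> real) \<Rightarrow> (nat \<Rightarrow> nat \<Rightarrow> real) \<Rightarrow> bool" where
  "compact_scheme \<alpha> q h M N t f g bl br \<phi> r s u v \<longleftrightarrow>
     (\<forall>n\<in>{0..N}. \<forall>i\<in>{1..M - 1}. g n i = 0) \<and>
     (\<forall>n\<in>{1..N}. \<forall>i\<in>{1..M - 1}.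
        avg M (\<lambda>j. L1_deriv \<alpha> t (\<lambda>k. u k j) n) i =
          - dxx h M (v n) i + q * avg M (u n) i + avg M (f n) i + r n i) \<and>
     (\<forall>n\<in>{0..N}. \<forall>i\<in>{0..M}. avg M (v n) i = dxx h M (u n) i + g n i + s n i) \<and>
     (\<forall>n\<in>{1..N}. u n 0 = bl n \<and> u n M = br n) \<and>
     (\<forall>i\<in>{0..M}. u 0 i = \<phi> i)"

text \<open>The right-hand side of the stability estimate at time level \<open>n\<close>, for a perturbation \<open>u\<close>.\<close>

definition stability_bound ::
  "real \<Rightarrow> real \<Rightarrow> real \<Rightarrow> real \<Rightarrow> nat \<Rightarrow> (nat \<Rightarrow> real) \<Rightarrow> (nat \<Rightarrow> nat \<Rightarrow> real) \<Rightarrow>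
   (nat \<Rightarrow> nat \<Rightarrow> real) \<Rightarrow> (nat \<Rightarrow> nat \<Rightarrow> real) \<Rightarrow> (nat \<Rightarrow> nat \<Rightarrow> real) \<Rightarrow> nat \<Rightarrow> real" where
  "stability_bound \<alpha> q \<rho> h M t u \<xi> \<zeta> \<eta> n =
     2 * mittag_leffler \<alpha> (4 * max q 0 * max 1 \<rho> * t n powr \<alpha>) *
       (grid_norm h M (avg M (u 0))
        + 2 * (MAX k\<in>{1..n}. \<Sum>j = 1..k. compl_kernel \<alpha> t k (k - j) * grid_norm h M (\<zeta> j))
        + 2 * Gamma (1 - \<alpha>) * (MAX k\<in>{1..n}. t k powr \<alpha> * grid_norm h M (\<xi> k))
        + sqrt (Gamma (1 - \<alpha>)) * (MAX k\<in>{1..n}. t k powr (\<alpha> / 2) * grid_norm h M (\<eta> k)))"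

end

theory Submission
  imports Defs
begin

text \<open>The evolution equation holds at interior nodes only, so the energy method is run with \<open>w k\<close>, the norm of
  \<open>avg (u k)\<close> over interior nodes; when \<open>u\<close> vanishes at both ends the full norm exceeds it by at most the factor \<open>8 / 7\<close>.
  Testing with \<open>avg (u n)\<close> and summing by parts gives
  \<open>w n * D w n \<le> q * (w n)^2 + (\<parallel>\<xi>\<parallel> + \<parallel>\<zeta>\<parallel>) * w n + 3/4 * \<parallel>\<eta>\<parallel>^2\<close>, where \<open>D\<close> is the L1 formula. After replacing \<open>w\<close> by its
  maximum with the bound \<open>G\<close> on the \<open>\<eta>\<close>-term one can divide by \<open>w n\<close>, which leaves a linear inequality for a
  discrete Gronwall argument with the complementary kernels. The linear form has growth rate \<open>q\<close>
  rather than \<open>2 * q\<close>, and under the step restriction no constant is lost in that argument; the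
  constants that remain satisfy \<open>8/7 * (1 + 3/4) = 2\<close>.\<close>

section \<open>Gamma, Mittag-Leffler and power kernels\<close>

text \<open>Log-convexity keeps \<open>ln (Gamma x)\<close> below its chord over
  \<open>[1, 2]\<close>, and the chord is zero because \<open>Gamma\<close> is \<open>1\<close> at
  both ends.\<close>

lemma Gamma_le_1:
  fixes x :: real
  assumes "1 \<le> x" "x \<le> 2"
  shows "Gamma x \<le> 1"
proof -
  have "(ln \<circ> Gamma) ((1 - (x - 1)) *\<^sub>R 1 + (x - 1) *\<^sub>R 2)
      \<le> (1 - (x - 1)) * (ln \<circ> Gamma) 1 + (x - 1) * (ln \<circ> Gamma) (2 :: real)"
    by (rule convex_onD[OF log_convex_Gamma_real]) (use assms in auto)
  moreover have "Gamma (2 :: real) = 1"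
    using Gamma_plus1[of "1 :: real"] by simp
  ultimately have "ln (Gamma x) \<le> 0"
    by (simp add: algebra_simps)
  then show ?thesis
    using assms by simp
qed

lemma Gamma_real_plus1: "0 < x \<Longrightarrow> Gamma (x + 1) = x * Gamma (x :: real)"
  by (rule Gamma_plus1) (auto elim!: nonpos_Ints_cases)

text \<open>Log-convexity again: \<open>x\<close> is the convex combination of \<open>x - 1\<close>
  and \<open>x + a\<close> with weights \<open>a / (1 + a)\<close> and \<open>1 / (1 + a)\<close>,
  and the functional equation eliminates \<open>Gamma (x - 1)\<close>. The bound controls ratios of
  consecutive Mittag-Leffler coefficients.\<close>

lemma Gamma_add_ge:
  fixes x a :: real
  assumes "1 < x" "0 < a"
  shows "(x - 1) powr a * Gamma x \<le> Gamma (x + a)"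
proof -
  let ?L = "\<lambda>y. ln (Gamma y :: real)"
  define s where "s = 1 / (1 + a)"
  have s: "0 \<le> s" "s \<le> 1" "s * (1 + a) = 1"
    using assms by (auto simp: s_def)
  have "(1 - s) * (x - 1) + s * (x + a) = x - 1 + s * (1 + a)"
    by (simp add: algebra_simps)
  then have x: "(1 - s) *\<^sub>R (x - 1) + s *\<^sub>R (x + a) = x"
    using s by simp
  have "(ln \<circ> Gamma) ((1 - s) *\<^sub>R (x - 1) + s *\<^sub>R (x + a))
      \<le> (1 - s) * (ln \<circ> Gamma) (x - 1) + s * (ln \<circ> Gamma) (x + a)"
    by (rule convex_onD[OF log_convex_Gamma_real]) (use assms s in auto)
  then have "?L x \<le> (1 - s) * ?L (x - 1) + s * ?L (x + a)"
    unfolding x by (simp add: o_def)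
  then have "(1 + a) * ?L x \<le> (1 + a) * ((1 - s) * ?L (x - 1) + s * ?L (x + a))"
    using assms by (intro mult_left_mono) auto
  also have "\<dots> = ((1 + a) - s * (1 + a)) * ?L (x - 1) + s * (1 + a) * ?L (x + a)"
    by (simp add: algebra_simps)
  finally have c: "(1 + a) * ?L x \<le> a * ?L (x - 1) + ?L (x + a)"
    using s by simp
  have "Gamma x = (x - 1) * Gamma (x - 1)"
    using Gamma_real_plus1[of "x - 1"] assms by simp
  then have "?L x = ln (x - 1) + ?L (x - 1)"
    using assms by (simp add: ln_mult_pos)
  with c have "(1 + a) * ?L x \<le> a * (?L x - ln (x - 1)) + ?L (x + a)"
    by simp
  then have "a * ln (x - 1) + ?L x \<le> ?L (x + a)"
    by (simp add: algebra_simps)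
  then have "exp (a * ln (x - 1) + ?L x) \<le> exp (?L (x + a))"
    by simp
  then show ?thesis
    using assms by (simp add: exp_add powr_def)
qed

text \<open>By \<open>Gamma_add_ge\<close> at \<open>1 + k * \<alpha>\<close> the ratio of
  consecutive terms is at most \<open>\<bar>z\<bar> / (k * \<alpha>) powr \<alpha>\<close>. It drops
  below \<open>1 / 2\<close> once \<open>k * \<alpha>\<close> exceeds the threshold
  \<open>X\<close>.\<close>

lemma summable_mittag_leffler:
  fixes \<alpha> z :: real
  assumes \<alpha>: "0 < \<alpha>"
  shows "summable (\<lambda>k. z ^ k / Gamma (1 + real k * \<alpha>))"
proof -
  define X where "X = (2 * \<bar>z\<bar>) powr (1 / \<alpha>)"
  obtain K where K: "X + 1 < real K * \<alpha>"
    using \<alpha> ex_less_of_nat_mult by blast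
  show ?thesis
  proof (rule summable_ratio_test[of "1/2" K])
    fix k assume k: "k \<ge> K"
    then have "real K * \<alpha> \<le> real k * \<alpha>"
      using \<alpha> by simp
    with K have kX: "X + 1 < real k * \<alpha>" by linarith
    have X0: "0 \<le> X" by (simp add: X_def)
    define g where "g = Gamma (1 + real k * \<alpha>)"
    define g' where "g' = Gamma (1 + real (Suc k) * \<alpha>)"
    have pos: "0 < g" "0 < g'"
      unfolding g_def g'_def using \<alpha> by (auto intro!: Gamma_real_pos add_pos_nonneg)
    have "2 * \<bar>z\<bar> = X powr \<alpha>"
      using \<alpha> by (simp add: X_def powr_powr)
    also have "\<dots> \<le> (real k * \<alpha>) powr \<alpha>"
      using kX X0 \<alpha> by (intro powr_mono2) auto
    finally have "2 * \<bar>z\<bar> * g \<le> (1 + real k * \<alpha> - 1) powr \<alpha> * g"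
      using pos by (simp add: mult_right_mono)
    also have "\<dots> \<le> g'"
      using Gamma_add_ge[of "1 + real k * \<alpha>" \<alpha>] kX X0 \<alpha>
      by (simp add: g_def g'_def algebra_simps)
    finally have "\<bar>z\<bar> / g' \<le> 1 / 2 / g"
      using pos by (simp add: field_simps)
    then have "\<bar>z\<bar> ^ k * (\<bar>z\<bar> / g') \<le> \<bar>z\<bar> ^ k * (1 / 2 / g)"
      by (intro mult_left_mono) auto
    then show "norm (z ^ Suc k / Gamma (1 + real (Suc k) * \<alpha>))
        \<le> 1 / 2 * norm (z ^ k / Gamma (1 + real k * \<alpha>))"
      unfolding g_def[symmetric] g'_def[symmetric] using pos
      by (simp add: abs_mult power_abs ac_simps)
  qed simp
qed

lemma mittag_leffler_sums:
  fixes \<alpha> z :: real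
  assumes "0 < \<alpha>"
  shows "(\<lambda>k. z ^ k / Gamma (1 + real k * \<alpha>)) sums mittag_leffler \<alpha> z"
  unfolding mittag_leffler_def by (intro summable_sums summable_mittag_leffler assms)

lemma mittag_leffler_ge:
  fixes \<alpha> z :: real
  assumes "0 < \<alpha>" "0 \<le> z"
  shows "1 + z / Gamma (1 + \<alpha>) \<le> mittag_leffler \<alpha> z"
proof -
  let ?f = "\<lambda>k. z ^ k / Gamma (1 + real k * \<alpha>)"
  have "sum ?f {..<2} \<le> suminf ?f"
    using assms by (intro sum_le_suminf summable_mittag_leffler)
      (auto intro!: divide_nonneg_pos Gamma_real_pos add_pos_nonneg)
  then show ?thesis
    by (simp add: mittag_leffler_def numeral_2_eq_2)
qed

section \<open>Power kernels, their primitives and convolutions\<close>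

lemma omega_pos: "0 < \<beta> \<Longrightarrow> 0 < x \<Longrightarrow> 0 < omega \<beta> x"
  by (simp add: omega_def)

lemma omega_nonneg: "0 < \<beta> \<Longrightarrow> 0 \<le> omega \<beta> x"
  by (simp add: omega_def)

lemma omega_0 [simp]: "omega \<beta> 0 = 0"
  by (simp add: omega_def)

lemma omega_mono: "1 \<le> \<beta> \<Longrightarrow> 0 \<le> x \<Longrightarrow> x \<le> y \<Longrightarrow> omega \<beta> x \<le> omega \<beta> y"
  unfolding omega_def by (intro divide_right_mono powr_mono2) auto

lemma omega_antimono: "0 < \<beta> \<Longrightarrow> \<beta> \<le> 1 \<Longrightarrow> 0 < x \<Longrightarrow> x \<le> y \<Longrightarrow> omega \<beta> y \<le> omega \<beta> x"
  unfolding omega_def by (intro divide_right_mono powr_mono2') auto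

lemma continuous_on_omega:
  assumes "0 < \<beta>"
  shows "continuous_on {0..} (omega (\<beta> + 1))"
proof -
  have "Gamma (\<beta> + 1) \<noteq> 0" using assms by (intro less_imp_neq[symmetric] Gamma_real_pos) simp
  then show ?thesis
    unfolding omega_def using assms by (intro continuous_intros continuous_on_powr') auto
qed

lemma DERIV_omega:
  assumes "0 < \<beta>" "0 < x"
  shows "(omega (\<beta> + 1) has_real_derivative omega \<beta> x) (at x)"
proof -
  have "Gamma (\<beta> + 1) = \<beta> * Gamma \<beta>"
    using assms Gamma_real_plus1 by simp
  moreover have "Gamma \<beta> \<noteq> 0" "Gamma (\<beta> + 1) \<noteq> 0"
    using assms by (intro less_imp_neq[symmetric] Gamma_real_pos; simp)+
  moreover have "((\<lambda>s. s powr \<beta> / Gamma (\<beta> + 1)) has_real_derivative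
      (\<beta> * x powr (\<beta> - 1)) / Gamma (\<beta> + 1)) (at x)"
    using assms by (intro DERIV_cdivide has_real_derivative_powr)
  ultimately show ?thesis
    using assms by (simp add: omega_def[abs_def])
qed

text \<open>The primitive \<open>omega (\<beta> + 1)\<close> is continuous up to \<open>0\<close>,
  so \<open>a = 0\<close> is allowed although \<open>omega \<beta>\<close> may be singular
  there.\<close>

lemma omega_MVT:
  assumes "0 < \<beta>" "0 \<le> a" "a < b"
  obtains z where "a < z" "z < b" "omega (\<beta> + 1) b - omega (\<beta> + 1) a = (b - a) * omega \<beta> z"
proof -
  have "\<exists>l z. a < z \<and> z < b \<and> DERIV (omega (\<beta> + 1)) z :> l \<and>
      omega (\<beta> + 1) b - omega (\<beta> + 1) a = (b - a) * l"
  proof (rule MVT[OF \<open>a < b\<close>])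
    show "continuous_on {a..b} (omega (\<beta> + 1))"
      by (rule continuous_on_subset[OF continuous_on_omega]) (use assms in auto)
    show "omega (\<beta> + 1) differentiable (at x)" if "a < x" "x < b" for x
      using DERIV_omega[of \<beta> x] assms that real_differentiable_def by force
  qed
  then obtain l z where z: "a < z" "z < b" "DERIV (omega (\<beta> + 1)) z :> l"
      "omega (\<beta> + 1) b - omega (\<beta> + 1) a = (b - a) * l" by blast
  moreover have "l = omega \<beta> z"
    using DERIV_unique[OF z(3) DERIV_omega] assms z by simp
  ultimately show ?thesis using that by blast
qed

text \<open>The interior form of the fundamental theorem is used because for
  \<open>\<beta> < 1\<close> the integrand is singular at \<open>0\<close>.\<close>

lemma omega_has_integral:
  assumes "0 < \<beta>" "0 \<le> a" "a \<le> b"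
  shows "(omega \<beta> has_integral (omega (\<beta> + 1) b - omega (\<beta> + 1) a)) {a..b}"
proof (rule fundamental_theorem_of_calculus_interior[OF \<open>a \<le> b\<close>])
  show "continuous_on {a..b} (omega (\<beta> + 1))"
    by (rule continuous_on_subset[OF continuous_on_omega]) (use assms in auto)
  show "(omega (\<beta> + 1) has_vector_derivative omega \<beta> x) (at x)" if "x \<in> {a<..<b}" for x
    using DERIV_omega[of \<beta> x] assms that has_real_derivative_iff_has_vector_derivative by auto
qed

lemma omega_reflected_has_integral:
  assumes "0 < \<beta>" "a \<le> b" "b \<le> x"
  shows "((\<lambda>s. omega \<beta> (x - s)) has_integral (omega (\<beta> + 1) (x - a) - omega (\<beta> + 1) (x - b))) {a..b}"
proof -
  have "((\<lambda>s. omega \<beta> (x - s)) has_integral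
      (- omega (\<beta> + 1) (x - b)) - (- omega (\<beta> + 1) (x - a))) {a..b}"
  proof (rule fundamental_theorem_of_calculus_interior[OF \<open>a \<le> b\<close>])
    have "continuous_on {a..b} (omega (\<beta> + 1) \<circ> (\<lambda>s. x - s))"
      by (intro continuous_on_compose continuous_intros
          continuous_on_subset[OF continuous_on_omega]) (use assms in auto)
    then show "continuous_on {a..b} (\<lambda>s. - omega (\<beta> + 1) (x - s))"
      by (auto simp: o_def intro: continuous_intros)
    fix s assume s: "s \<in> {a<..<b}"
    have "((\<lambda>s. - omega (\<beta> + 1) (x - s)) has_real_derivative - (omega \<beta> (x - s) * (0 - 1))) (at s)"
      using s assms by (intro DERIV_minus DERIV_chain'[where g = "omega (\<beta> + 1)"] DERIV_omega
          derivative_intros) auto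
    then show "((\<lambda>s. - omega (\<beta> + 1) (x - s)) has_vector_derivative omega \<beta> (x - s)) (at s)"
      by (simp add: has_real_derivative_iff_has_vector_derivative)
  qed
  then show ?thesis by simp
qed

text \<open>The semigroup law of fractional integration: Euler's Beta integral, stretched from
  \<open>[0, 1]\<close> to \<open>[0, x]\<close>.\<close>

lemma omega_convolution:
  assumes "0 < \<beta>" "0 < \<gamma>" "0 < x"
  shows "((\<lambda>s. omega \<beta> (x - s) * omega \<gamma> s) has_integral omega (\<beta> + \<gamma>) x) {0..x}"
proof -
  have B: "((\<lambda>s. s powr (\<gamma> - 1) * (1 - s) powr (\<beta> - 1)) has_integral Beta \<gamma> \<beta>) {0..1}"
    by (rule has_integral_Beta_real) (use assms in auto)
  have im: "(\<lambda>s. s / (1 / x)) ` {0..1} = {0..x}"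
  proof -
    have "(\<lambda>s. s * x) ` {0..1} = {0..x}"
      using assms image_mult_atLeastAtMost[of x 0 1] by (simp add: mult.commute)
    then show ?thesis by simp
  qed
  have "((\<lambda>s. (1 / x * s) powr (\<gamma> - 1) * (1 - 1 / x * s) powr (\<beta> - 1)) has_integral
      (1 / \<bar>1 / x\<bar>) *\<^sub>R Beta \<gamma> \<beta>) ((\<lambda>s. s / (1 / x)) ` {0..1})"
    by (rule has_integral_stretch_real[OF B]) (use assms in auto)
  then have S: "((\<lambda>s. (s / x) powr (\<gamma> - 1) * (1 - s / x) powr (\<beta> - 1)) has_integral x * Beta \<gamma> \<beta>) {0..x}"
    unfolding im using assms by simp
  \<comment> \<open>\<open>c\<close> collects the powers of \<open>x\<close> left by the stretching
    and the two Gamma normalisations; the remaining factor \<open>x\<close> in \<open>S\<close> is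
    the Jacobian.\<close>
  define c where "c = x powr (\<beta> + \<gamma> - 2) / (Gamma \<beta> * Gamma \<gamma>)"
  have "((\<lambda>s. c * ((s / x) powr (\<gamma> - 1) * (1 - s / x) powr (\<beta> - 1))) has_integral c * (x * Beta \<gamma> \<beta>)) {0..x}"
    by (rule has_integral_mult_right[OF S])
  moreover have "c * (x * Beta \<gamma> \<beta>) = omega (\<beta> + \<gamma>) x"
  proof -
    have "x powr (\<beta> + \<gamma> - 2) * x = x powr (\<beta> + \<gamma> - 1)"
      using assms powr_add[of x "\<beta> + \<gamma> - 2" 1] by simp
    moreover have "Gamma \<beta> > 0" "Gamma \<gamma> > 0" using assms by auto
    ultimately show ?thesis
      by (simp add: c_def Beta_def omega_def field_simps)
  qed
  moreover have "c * ((s / x) powr (\<gamma> - 1) * (1 - s / x) powr (\<beta> - 1)) = omega \<beta> (x - s) * omega \<gamma> s"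
    if "s \<in> {0..x}" for s
  proof -
    have "1 - s / x = (x - s) / x" using assms by (simp add: field_simps)
    moreover have "x powr (\<beta> + \<gamma> - 2) = x powr (\<beta> - 1) * x powr (\<gamma> - 1)"
      by (simp add: powr_add[symmetric])
    moreover have "x powr (\<beta> - 1) > 0" "x powr (\<gamma> - 1) > 0" using assms by auto
    ultimately show ?thesis
      using assms that by (simp add: c_def omega_def powr_divide)
  qed
  ultimately show ?thesis
    by (metis (no_types, lifting) has_integral_cong)
qed

lemma convolution_integrable:
  assumes "0 < \<beta>" "0 < \<gamma>" "0 \<le> a" "a < b" "b \<le> x"
  shows "(\<lambda>s. omega \<beta> (x - s) * omega \<gamma> s) integrable_on {a..b}"
proof -
  have "(\<lambda>s. omega \<beta> (x - s) * omega \<gamma> s) integrable_on {0..x}"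
    using omega_convolution[of \<beta> \<gamma> x] assms by (auto simp: integrable_on_def)
  then show ?thesis
    by (rule integrable_subinterval_real) (use assms in auto)
qed

text \<open>For \<open>1 \<le> \<gamma>\<close> the factor \<open>omega \<gamma>\<close> increases
  and is replaced by its value at the right end of the cell. The name refers to the convexity of
  \<open>omega (\<gamma> + 1)\<close>.\<close>

lemma convolution_integral_le_convex:
  assumes "0 < \<beta>" "1 \<le> \<gamma>" "0 \<le> a" "a < b" "b \<le> x"
  shows "integral {a..b} (\<lambda>s. omega \<beta> (x - s) * omega \<gamma> s)
      \<le> integral {a..b} (\<lambda>s. omega \<beta> (x - s)) * omega \<gamma> b"
proof -
  have K: "(\<lambda>s. omega \<beta> (x - s)) integrable_on {a..b}"
    using omega_reflected_has_integral[of \<beta> a b x] assms by (auto simp: integrable_on_def)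
  have "integral {a..b} (\<lambda>s. omega \<beta> (x - s) * omega \<gamma> s)
      \<le> integral {a..b} (\<lambda>s. omega \<beta> (x - s) * omega \<gamma> b)"
    using assms K
    by (intro integral_le convolution_integrable integrable_on_mult_left mult_left_mono omega_mono
        omega_nonneg) auto
  then show ?thesis by simp
qed

text \<open>Chebyshev's inequality for an increasing and a decreasing function: at the mean-value point \<open>z\<close> both
  factors change sides.\<close>

lemma convolution_integral_le_concave:
  assumes "0 < \<beta>" "\<beta> \<le> 1" "0 < \<gamma>" "\<gamma> \<le> 1" "0 \<le> a" "a < b" "b \<le> x"
  shows "(b - a) * integral {a..b} (\<lambda>s. omega \<beta> (x - s) * omega \<gamma> s)
      \<le> integral {a..b} (\<lambda>s. omega \<beta> (x - s)) * (omega (\<gamma> + 1) b - omega (\<gamma> + 1) a)"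
proof -
  obtain z where z: "a < z" "z < b" "omega (\<gamma> + 1) b - omega (\<gamma> + 1) a = (b - a) * omega \<gamma> z"
    using omega_MVT[of \<gamma> a b] assms by auto
  let ?f = "\<lambda>s. omega \<beta> (x - s) * omega \<gamma> s"
  let ?K = "integral {a..b} (\<lambda>s. omega \<beta> (x - s))"
  have K: "((\<lambda>s. omega \<beta> (x - s)) has_integral ?K) {a..b}"
    using omega_reflected_has_integral[of \<beta> a b x] assms by (simp add: has_integral_iff)
  have c: "(omega \<gamma> has_integral (b - a) * omega \<gamma> z) {a..b}"
    using omega_has_integral[of \<gamma> a b] assms z by simp
  have z': "((\<lambda>s. omega \<gamma> z) has_integral (b - a) * omega \<gamma> z) {a..b}"
    using has_integral_const_real[of "omega \<gamma> z" a b] assms by simp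
  have f: "(?f has_integral integral {a..b} ?f) {a..b}"
    using convolution_integrable[of \<beta> \<gamma> a b x] assms by auto
  have "((\<lambda>s. omega \<beta> (x - s) * omega \<gamma> z + omega \<beta> (x - z) * (omega \<gamma> s - omega \<gamma> z))
      has_integral ?K * omega \<gamma> z + omega \<beta> (x - z) * ((b - a) * omega \<gamma> z - (b - a) * omega \<gamma> z)) {a..b}"
    by (intro has_integral_add has_integral_mult_left has_integral_mult_right has_integral_diff K c z')
  then have g: "((\<lambda>s. omega \<beta> (x - s) * omega \<gamma> z + omega \<beta> (x - z) * (omega \<gamma> s - omega \<gamma> z))
      has_integral ?K * omega \<gamma> z) {a..b}"
    by simp
  have "integral {a..b} ?f \<le> ?K * omega \<gamma> z"
  proof (rule has_integral_le[OF f[unfolded has_integral_Icc_iff_Ioo] g[unfolded has_integral_Icc_iff_Ioo]])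
    fix s assume s: "s \<in> {a<..<b}"
    have "(omega \<beta> (x - s) - omega \<beta> (x - z)) * (omega \<gamma> s - omega \<gamma> z) \<le> 0"
    proof (cases "s \<le> z")
      case True
      have "omega \<beta> (x - s) \<le> omega \<beta> (x - z)" "omega \<gamma> z \<le> omega \<gamma> s"
        using assms s z True by (auto intro!: omega_antimono)
      then show ?thesis by (intro mult_nonpos_nonneg) auto
    next
      case False
      have "omega \<beta> (x - z) \<le> omega \<beta> (x - s)" "omega \<gamma> s \<le> omega \<gamma> z"
        using assms s z False by (auto intro!: omega_antimono)
      then show ?thesis by (intro mult_nonneg_nonpos) auto
    qed
    then show "?f s \<le> omega \<beta> (x - s) * omega \<gamma> z + omega \<beta> (x - z) * (omega \<gamma> s - omega \<gamma> z)"
      by (simp add: algebra_simps)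
  qed
  then have "(b - a) * integral {a..b} ?f \<le> (b - a) * (?K * omega \<gamma> z)"
    using assms by (intro mult_left_mono) auto
  then show ?thesis unfolding z(3) by (simp only: ac_simps)
qed

section \<open>The L1 kernels and discrete Gronwall\<close>

lemma sum_triangle_swap:
  fixes f :: "nat \<Rightarrow> nat \<Rightarrow> 'a::comm_monoid_add"
  shows "(\<Sum>j = 1..n. \<Sum>k = 1..j. f j k) = (\<Sum>k = 1..n. \<Sum>j = k..n. f j k)"
proof (induction n)
  case (Suc n)
  have "(\<Sum>k = 1..n. \<Sum>j = k..Suc n. f j k) = (\<Sum>k = 1..n. (\<Sum>j = k..n. f j k) + f (Suc n) k)"
    by (intro sum.cong) auto
  with Suc show ?case by (simp add: sum.distrib ac_simps)
qed simp

text \<open>Abel summation. Applied to the L1 kernels, it moves the differences onto coefficients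
  whose increments have a known sign.\<close>

lemma sum_by_parts:
  fixes b w :: "nat \<Rightarrow> real"
  assumes "1 \<le> n"
  shows "(\<Sum>k = 1..n. b k * (w k - w (k - 1))) =
      b n * w n - (\<Sum>k = 1..<n. (b (k + 1) - b k) * w k) - b 1 * w 0"
  using assms by (induction n rule: nat_induct_at_least) (simp_all add: algebra_simps)

text \<open>The last level \<open>N\<close> is a parameter, so that each level of the full mesh can
  later be treated as the last one.\<close>

locale L1_mesh =
  fixes \<alpha> :: real and t :: "nat \<Rightarrow> real" and N :: nat
  assumes \<alpha>: "0 < \<alpha>" "\<alpha> < 1"
    and t0: "t 0 = 0"
    and t_step: "\<And>k. 1 \<le> k \<Longrightarrow> k \<le> N \<Longrightarrow> t (k - 1) < t k"
begin

text \<open>The kernels are indexed by time levels: \<open>A n k\<close> is $a_{n-k}^{(n)}$ and \<open>P n j\<close> is $p_{n-j}^{(n)}$.\<close>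

abbreviation A :: "nat \<Rightarrow> nat \<Rightarrow> real" where
  "A n k \<equiv> L1_kernel \<alpha> t n (n - k)"

abbreviation P :: "nat \<Rightarrow> nat \<Rightarrow> real" where
  "P n j \<equiv> compl_kernel \<alpha> t n (n - j)"

lemma t_mono: "i \<le> j \<Longrightarrow> j \<le> N \<Longrightarrow> t i \<le> t j"
proof (induction j rule: dec_induct)
  case (step j)
  then show ?case using t_step[of "Suc j"] by simp
qed simp

lemma t_strict_mono: "i < j \<Longrightarrow> j \<le> N \<Longrightarrow> t i < t j"
  using t_mono[of i "j - 1"] t_step[of j] by fastforce

lemma t_pos: "1 \<le> k \<Longrightarrow> k \<le> N \<Longrightarrow> 0 < t k"
  using t_strict_mono[of 0 k] t0 by simp

lemma t_nonneg: "k \<le> N \<Longrightarrow> 0 \<le> t k"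
  using t_mono[of 0 k] t0 by simp

lemma tstep_pos: "1 \<le> k \<Longrightarrow> k \<le> N \<Longrightarrow> 0 < tstep t k"
  using t_step[of k] by (simp add: tstep_def)

lemma tstep_le: "1 \<le> k \<Longrightarrow> k \<le> N \<Longrightarrow> tstep t k \<le> t k"
  using t_nonneg[of "k - 1"] by (simp add: tstep_def)

lemma tstep_times_A:
  assumes "1 \<le> k" "k \<le> n" "n \<le> N"
  shows "tstep t k * A n k = integral {t (k - 1)..t k} (\<lambda>s. omega (1 - \<alpha>) (t n - s))"
  using assms tstep_pos[of k] by (simp add: L1_kernel_def)

lemma A_closed_form:
  assumes "1 \<le> k" "k \<le> n" "n \<le> N"
  shows "A n k = (omega (2 - \<alpha>) (t n - t (k - 1)) - omega (2 - \<alpha>) (t n - t k)) / tstep t k"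
proof -
  have "((\<lambda>s. omega (1 - \<alpha>) (t n - s)) has_integral
      (omega (1 - \<alpha> + 1) (t n - t (k - 1)) - omega (1 - \<alpha> + 1) (t n - t k))) {t (k - 1)..t k}"
    using assms \<alpha> t_mono[of k n] t_mono[of "k - 1" k]
    by (intro omega_reflected_has_integral) auto
  then show ?thesis
    using assms by (simp add: L1_kernel_def integral_unique)
qed

text \<open>The diagonal kernel is needed exactly: its reciprocal is the quantity controlled by the
  step restriction. The second \<open>omega\<close> term of the closed form vanishes at
  \<open>0\<close>.\<close>

lemma A_diag:
  assumes "1 \<le> n" "n \<le> N"
  shows "A n n = 1 / (Gamma (2 - \<alpha>) * tstep t n powr \<alpha>)"
proof -
  have "tstep t n powr (1 - \<alpha>) = tstep t n / tstep t n powr \<alpha>"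
    using tstep_pos[OF assms] by (simp add: powr_diff)
  then show ?thesis
    unfolding A_closed_form[OF assms(1) order_refl assms(2)] tstep_def[symmetric]
    using tstep_pos[OF assms] by (simp add: omega_def)
qed

text \<open>Every kernel is a value of the decreasing function \<open>omega (1 - \<alpha>)\<close>
  at a point of its cell. Positivity, monotonicity in \<open>k\<close> and comparison with
  \<open>t n\<close> then reduce to the ordering of the cells.\<close>

lemma A_MVT:
  assumes "1 \<le> k" "k \<le> n" "n \<le> N"
  obtains z where "t n - t k < z" "z < t n - t (k - 1)" "A n k = omega (1 - \<alpha>) z"
proof -
  obtain z where z: "t n - t k < z" "z < t n - t (k - 1)"
    "omega (1 - \<alpha> + 1) (t n - t (k - 1)) - omega (1 - \<alpha> + 1) (t n - t k)
      = ((t n - t (k - 1)) - (t n - t k)) * omega (1 - \<alpha>) z"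
    using omega_MVT[of "1 - \<alpha>" "t n - t k" "t n - t (k - 1)"] \<alpha> assms t_mono[of k n] t_step[of k] by auto
  have "A n k = omega (1 - \<alpha>) z"
    using A_closed_form[OF assms] z(3) tstep_pos[of k] assms by (simp add: tstep_def)
  then show ?thesis using that z by blast
qed

lemma A_pos:
  assumes "1 \<le> k" "k \<le> n" "n \<le> N"
  shows "0 < A n k"
proof -
  obtain z where "t n - t k < z" "A n k = omega (1 - \<alpha>) z"
    using A_MVT[OF assms] .
  then show ?thesis
    using \<alpha> t_mono[of k n] assms by (auto intro!: omega_pos)
qed

lemma A_mono:
  assumes "1 \<le> k" "k < n" "n \<le> N"
  shows "A n k \<le> A n (k + 1)"
proof -
  obtain z where z: "t n - t k < z" "A n k = omega (1 - \<alpha>) z"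
    using A_MVT[of k n] assms by auto
  obtain z' where z': "t n - t (k + 1) < z'" "z' < t n - t k" "A n (k + 1) = omega (1 - \<alpha>) z'"
    using A_MVT[of "k + 1" n] assms by auto
  show ?thesis
    unfolding z z' using z z' \<alpha> t_mono[of "k + 1" n] assms by (intro omega_antimono) auto
qed

lemma omega_le_A:
  assumes "1 \<le> n" "n \<le> N"
  shows "omega (1 - \<alpha>) (t n) \<le> A n 1"
proof -
  obtain z where "t n - t 1 < z" "z < t n - t (1 - 1)" "A n 1 = omega (1 - \<alpha>) z"
    using A_MVT[of 1 n] assms by blast
  then show ?thesis
    using \<alpha> t_mono[of 1 n] assms t0 by (auto intro!: omega_antimono)
qed

section \<open>Comparison and energy inequalities for the L1 formula\<close>

lemma L1_deriv_by_parts: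
  assumes "1 \<le> n"
  shows "L1_deriv \<alpha> t w n =
      A n n * w n - (\<Sum>k = 1..<n. (A n (k + 1) - A n k) * w k) - A n 1 * w 0"
  unfolding L1_deriv_def using sum_by_parts[OF assms, of "A n" w] by simp

text \<open>A discrete comparison principle: after summation by parts all earlier values enter with
  nonpositive coefficients, by \<open>A_mono\<close> and \<open>A_pos\<close>.\<close>

lemma L1_deriv_antimono:
  assumes n: "1 \<le> n" "n \<le> N" and "w n = w' n" "\<And>k. k < n \<Longrightarrow> w k \<le> w' k"
  shows "L1_deriv \<alpha> t w' n \<le> L1_deriv \<alpha> t w n"
proof -
  have "(\<Sum>k = 1..<n. (A n (k + 1) - A n k) * w k) \<le> (\<Sum>k = 1..<n. (A n (k + 1) - A n k) * w' k)"
    using assms A_mono[of _ n] by (intro sum_mono mult_left_mono) auto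
  moreover have "A n 1 * w 0 \<le> A n 1 * w' 0"
    using assms A_pos[of 1 n] by (intro mult_left_mono) auto
  ultimately show ?thesis
    unfolding L1_deriv_by_parts[OF n(1)] using assms by simp
qed

text \<open>Comparison with the constant sequence of value \<open>w n\<close>, on which the L1
  formula vanishes.\<close>

lemma L1_deriv_nonpos:
  assumes "1 \<le> n" "n \<le> N" "\<And>k. k < n \<Longrightarrow> w n \<le> w k"
  shows "L1_deriv \<alpha> t w n \<le> 0"
  using L1_deriv_antimono[of n "\<lambda>_. w n" w] assms by (simp add: L1_deriv_def)

text \<open>After summation by parts the diagonal terms of both sides agree. All other terms carry
  nonpositive coefficients, so Cauchy-Schwarz acts in the right direction.\<close>

lemma L2_set_L1_deriv_le:
  fixes y :: "nat \<Rightarrow> nat \<Rightarrow> real" and I :: "nat set"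
  assumes n: "1 \<le> n" "n \<le> N"
  defines "w \<equiv> \<lambda>k. L2_set (y k) I"
  shows "w n * L1_deriv \<alpha> t w n \<le> (\<Sum>i\<in>I. y n i * L1_deriv \<alpha> t (\<lambda>k. y k i) n)"
proof -
  define ip where "ip k = (\<Sum>i\<in>I. y n i * y k i)" for k
  have CS: "ip k \<le> w n * w k" for k
  proof -
    have "ip k \<le> (\<Sum>i\<in>I. \<bar>y n i\<bar> * \<bar>y k i\<bar>)"
      unfolding ip_def by (intro sum_mono) (simp add: abs_mult[symmetric])
    then show ?thesis
      unfolding w_def using L2_set_mult_ineq[where A = I and f = "y n" and g = "y k"] by simp
  qed
  have sq: "w n * w n = ip n"
    by (simp add: w_def ip_def L2_set_def power2_eq_square[symmetric] sum_nonneg)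
  have "(\<Sum>k = 1..<n. (A n (k + 1) - A n k) * ip k)
      \<le> (\<Sum>k = 1..<n. (A n (k + 1) - A n k) * (w n * w k))"
    using n A_mono[of _ n] CS by (intro sum_mono mult_left_mono) auto
  moreover have "A n 1 * ip 0 \<le> A n 1 * (w n * w 0)"
    using n A_pos[of 1 n] CS by (intro mult_left_mono) auto
  moreover have "w n * L1_deriv \<alpha> t w n =
      A n n * ip n - (\<Sum>k = 1..<n. (A n (k + 1) - A n k) * (w n * w k)) - A n 1 * (w n * w 0)"
    unfolding L1_deriv_by_parts[OF n(1)] sq[symmetric] by (simp add: algebra_simps sum_distrib_left)
  moreover have "(\<Sum>i\<in>I. y n i * L1_deriv \<alpha> t (\<lambda>k. y k i) n) =
      A n n * ip n - (\<Sum>k = 1..<n. (A n (k + 1) - A n k) * ip k) - A n 1 * ip 0"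
  proof -
    have "(\<Sum>i\<in>I. y n i * L1_deriv \<alpha> t (\<lambda>k. y k i) n) =
      (\<Sum>i\<in>I. A n n * (y n i * y n i) - (\<Sum>k = 1..<n. (A n (k + 1) - A n k) * (y n i * y k i))
        - A n 1 * (y n i * y 0 i))"
      unfolding L1_deriv_by_parts[OF n(1)] by (intro sum.cong) (simp_all add: algebra_simps sum_distrib_left)
    also have "\<dots> = A n n * ip n - (\<Sum>i\<in>I. \<Sum>k = 1..<n. (A n (k + 1) - A n k) * (y n i * y k i)) - A n 1 * ip 0"
      by (simp add: sum_subtractf ip_def sum_distrib_left)
    also have "(\<Sum>i\<in>I. \<Sum>k = 1..<n. (A n (k + 1) - A n k) * (y n i * y k i)) =
        (\<Sum>k = 1..<n. (A n (k + 1) - A n k) * ip k)"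
      unfolding ip_def sum_distrib_left by (rule sum.swap)
    finally show ?thesis .
  qed
  ultimately show ?thesis by linarith
qed

section \<open>Complementary kernels as a discrete fractional integral\<close>

lemma P_diag: "P n n = 1 / A n n"
  by (subst compl_kernel.simps) simp

lemma P_rec:
  assumes "j < n"
  shows "P n j = (\<Sum>k = j + 1..n. (A k (j + 1) - A k j) * P n k) / A j j"
  using assms by (subst compl_kernel.simps) (simp add: Let_def)

lemma P_nonneg:
  assumes "1 \<le> j" "j \<le> n" "n \<le> N"
  shows "0 \<le> P n j"
  using assms
proof (induction "n - j" arbitrary: j rule: less_induct)
  case less
  show ?case
  proof (cases "j = n")
    case True
    then show ?thesis using A_pos[of n n] less.prems P_diag[of n] by simp
  next
    case False
    have "0 \<le> (\<Sum>k = j + 1..n. (A k (j + 1) - A k j) * P n k)"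
      using less A_mono[of j] by (intro sum_nonneg mult_nonneg_nonneg) auto
    then show ?thesis
      using False A_pos[of j j] less.prems P_rec[of j n] by simp
  qed
qed

text \<open>The recursion for \<open>P\<close> says precisely that the sum for \<open>k\<close>
  equals the sum for \<open>k + 1\<close>, so downward induction carries the value from
  \<open>k = n\<close>.\<close>

lemma sum_P_A:
  assumes "1 \<le> k" "k \<le> n" "n \<le> N"
  shows "(\<Sum>j = k..n. P n j * A j k) = 1"
  using assms(2,1)
proof (induction k rule: inc_induct)
  case base
  then show ?case using A_pos[of n n] assms P_diag[of n] by simp
next
  case (step k)
  have "P n k * A k k = (\<Sum>j = k + 1..n. P n j * (A j (k + 1) - A j k))"
    using P_rec[of k n] step A_pos[of k k] assms by (simp add: ac_simps)
  then have "P n k * A k k + (\<Sum>j = k + 1..n. P n j * A j k) = (\<Sum>j = k + 1..n. P n j * A j (k + 1))"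
    by (simp add: right_diff_distrib sum_subtractf)
  with step show ?case by (simp add: sum.atLeast_Suc_atMost)
qed

text \<open>Exchanging the sums leaves each increment of \<open>w\<close> with the weight from
  \<open>sum_P_A\<close>, which is \<open>1\<close>. Thus \<open>P\<close> inverts the L1 formula up
  to the initial value.\<close>

lemma sum_P_L1_deriv:
  assumes "1 \<le> n" "n \<le> N"
  shows "(\<Sum>j = 1..n. P n j * L1_deriv \<alpha> t w j) = w n - w 0"
proof -
  have "(\<Sum>j = 1..n. P n j * L1_deriv \<alpha> t w j) =
      (\<Sum>j = 1..n. \<Sum>k = 1..j. P n j * A j k * (w k - w (k - 1)))"
    unfolding L1_deriv_def sum_distrib_left by (simp only: ac_simps)
  also have "\<dots> = (\<Sum>k = 1..n. (\<Sum>j = k..n. P n j * A j k) * (w k - w (k - 1)))"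
    unfolding sum_triangle_swap sum_distrib_right ..
  also have "\<dots> = (\<Sum>k = 1..n. w k - w (k - 1))"
    using assms by (intro sum.cong) (simp_all only: sum_P_A atLeastAtMost_iff mult_1)
  also have "\<dots> = w n - w 0"
    by (induction n) auto
  finally show ?thesis .
qed

text \<open>The kernel of the first cell dominates \<open>omega (1 - \<alpha>) (t j)\<close>, so
  \<open>sum_P_A\<close> with \<open>k = 1\<close> applies. This is where the weights in time of the
  \<open>\<xi>\<close> and \<open>\<eta>\<close> terms come from.\<close>

lemma sum_P_omega_le_1:
  assumes "1 \<le> n" "n \<le> N"
  shows "(\<Sum>j = 1..n. P n j * omega (1 - \<alpha>) (t j)) \<le> 1"
proof -
  have "(\<Sum>j = 1..n. P n j * omega (1 - \<alpha>) (t j)) \<le> (\<Sum>j = 1..n. P n j * A j 1)"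
    using assms by (intro sum_mono mult_left_mono omega_le_A P_nonneg) auto
  then show ?thesis
    using sum_P_A[of 1 n] assms by simp
qed

section \<open>Complementary sums of powers and of Mittag-Leffler functions\<close>

lemma integral_mesh_split:
  assumes "m \<le> N" "f integrable_on {0..t m}"
  shows "integral {0..t m} f = (\<Sum>i = 1..m. integral {t (i - 1)..t i} (f :: real \<Rightarrow> real))"
  using assms
proof (induction m)
  case (Suc m)
  have m: "t m \<le> t (Suc m)" "0 \<le> t m"
    using t_mono[of m "Suc m"] t_nonneg[of m] Suc.prems by auto
  have "f integrable_on {0..t m}"
    using Suc.prems(2) by (rule integrable_subinterval_real) (use m in auto)
  with Suc have "integral {0..t m} f = (\<Sum>i = 1..m. integral {t (i - 1)..t i} f)" by simp
  moreover have "integral {0..t m} f + integral {t m..t (Suc m)} f = integral {0..t (Suc m)} f"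
    by (rule Henstock_Kurzweil_Integration.integral_combine) (use m Suc.prems in auto)
  ultimately show ?case by simp
qed (simp add: t0)

text \<open>The power is written as the convolution of \<open>omega (1 - \<alpha>)\<close> with
  \<open>omega \<gamma>\<close> and split into cells; exchanging the sums then leaves weights at
  most \<open>1\<close> on the cell bounds \<open>d i\<close>. Level \<open>n\<close> is left out
  because the Gronwall argument treats the implicit term separately.\<close>

lemma sum_P_omega_le_sum:
  assumes n: "1 \<le> n" "n \<le> N" and \<gamma>: "0 < \<gamma>"
    and d: "\<And>i. 1 \<le> i \<Longrightarrow> i < n \<Longrightarrow> 0 \<le> d i"
    and le: "\<And>i j. 1 \<le> i \<Longrightarrow> i \<le> j \<Longrightarrow> j < n \<Longrightarrow>
      integral {t (i - 1)..t i} (\<lambda>s. omega (1 - \<alpha>) (t j - s) * omega \<gamma> s) \<le> A j i * d i"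
  shows "(\<Sum>j = 1..n - 1. P n j * omega (1 - \<alpha> + \<gamma>) (t j)) \<le> (\<Sum>i = 1..n - 1. d i)"
proof -
  have "omega (1 - \<alpha> + \<gamma>) (t j) \<le> (\<Sum>i = 1..j. A j i * d i)" if j: "j \<in> {1..n - 1}" for j
  proof -
    let ?f = "\<lambda>s. omega (1 - \<alpha>) (t j - s) * omega \<gamma> s"
    have jn: "1 \<le> j" "j \<le> N" "j < n" using j n by auto
    have "(?f has_integral omega (1 - \<alpha> + \<gamma>) (t j)) {0..t j}"
      by (rule omega_convolution) (use \<alpha> \<gamma> jn t_pos in auto)
    then have "omega (1 - \<alpha> + \<gamma>) (t j) = (\<Sum>i = 1..j. integral {t (i - 1)..t i} ?f)"
      using integral_mesh_split[of j ?f] jn by (simp add: has_integral_iff)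
    also have "\<dots> \<le> (\<Sum>i = 1..j. A j i * d i)"
      using le jn by (intro sum_mono) auto
    finally show ?thesis .
  qed
  then have "(\<Sum>j = 1..n - 1. P n j * omega (1 - \<alpha> + \<gamma>) (t j)) \<le>
      (\<Sum>j = 1..n - 1. P n j * (\<Sum>i = 1..j. A j i * d i))"
    using n by (intro sum_mono mult_left_mono P_nonneg) auto
  also have "\<dots> = (\<Sum>j = 1..n - 1. \<Sum>i = 1..j. P n j * A j i * d i)"
    unfolding sum_distrib_left by (simp only: ac_simps)
  also have "\<dots> = (\<Sum>i = 1..n - 1. (\<Sum>j = i..n - 1. P n j * A j i) * d i)"
    unfolding sum_triangle_swap sum_distrib_right ..
  also have "\<dots> \<le> (\<Sum>i = 1..n - 1. 1 * d i)"
  proof (intro sum_mono mult_right_mono)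
    fix i assume i: "i \<in> {1..n - 1}"
    \<comment> \<open>The missing term \<open>j = n\<close> is nonnegative, so the truncated sum is
      at most the full one, which equals \<open>1\<close>.\<close>
    have "(\<Sum>j = i..n - 1. P n j * A j i) \<le> (\<Sum>j = i..n. P n j * A j i)"
      using i n A_pos by (intro sum_mono2 mult_nonneg_nonneg P_nonneg) (auto intro!: less_imp_le)
    then show "(\<Sum>j = i..n - 1. P n j * A j i) \<le> 1"
      using sum_P_A[of i n] i n by auto
    show "0 \<le> d i" using d i by auto
  qed
  finally show ?thesis by simp
qed

text \<open>For convex \<open>omega (\<gamma> + 1)\<close> the slope at the right end of a cell is compared with the mean slope on the
  next cell, which is where the step ratios enter.\<close>

lemma sum_P_omega_le:
  assumes n: "1 \<le> n" "n \<le> N" and \<gamma>: "0 < \<gamma>"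
    and \<rho>: "\<And>k. 1 \<le> k \<Longrightarrow> k < N \<Longrightarrow> tstep t k \<le> \<rho> * tstep t (k + 1)"
  shows "(\<Sum>j = 1..n - 1. P n j * omega (1 - \<alpha> + \<gamma>) (t j)) \<le> max 1 \<rho> * omega (\<gamma> + 1) (t n)"
proof (cases "1 \<le> \<gamma>")
  case True
  define d where "d i = tstep t i * omega \<gamma> (t i)" for i
  have "(\<Sum>j = 1..n - 1. P n j * omega (1 - \<alpha> + \<gamma>) (t j)) \<le> (\<Sum>i = 1..n - 1. d i)"
  proof (rule sum_P_omega_le_sum[OF n \<gamma>])
    show "0 \<le> d i" if "1 \<le> i" "i < n" for i
      using tstep_pos[of i] that n \<gamma> by (auto simp: d_def intro!: mult_nonneg_nonneg omega_nonneg)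
    fix i j assume ij: "1 \<le> i" "i \<le> j" "j < n"
    have "integral {t (i - 1)..t i} (\<lambda>s. omega (1 - \<alpha>) (t j - s) * omega \<gamma> s) \<le>
        integral {t (i - 1)..t i} (\<lambda>s. omega (1 - \<alpha>) (t j - s)) * omega \<gamma> (t i)"
      by (rule convolution_integral_le_convex)
        (use \<alpha> True ij n t_nonneg t_step t_mono in auto)
    also have "\<dots> = A j i * d i"
      using tstep_times_A[of i j, symmetric] ij n by (simp add: d_def)
    finally show "integral {t (i - 1)..t i} (\<lambda>s. omega (1 - \<alpha>) (t j - s) * omega \<gamma> s) \<le> A j i * d i" .
  qed
  also have "\<dots> \<le> (\<Sum>i = 1..n - 1. max 1 \<rho> * (omega (\<gamma> + 1) (t (i + 1)) - omega (\<gamma> + 1) (t i)))"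
  proof (intro sum_mono)
    fix i assume i: "i \<in> {1..n - 1}"
    then have i': "1 \<le> i" "i \<le> N" "i + 1 \<le> N" using n by auto
    have c: "0 \<le> t i" "t i < t (i + 1)"
      using t_nonneg[of i] t_step[of "i + 1"] i' by auto
    obtain z where z: "t i < z" "z < t (i + 1)"
      "omega (\<gamma> + 1) (t (i + 1)) - omega (\<gamma> + 1) (t i) = (t (i + 1) - t i) * omega \<gamma> z"
      using omega_MVT[OF \<gamma> c] .
    have "omega \<gamma> (t i) \<le> omega \<gamma> z"
      using z t_nonneg[of i] i' True by (intro omega_mono) auto
    moreover have "tstep t i \<le> max 1 \<rho> * tstep t (i + 1)"
    proof -
      have "\<rho> * tstep t (i + 1) \<le> max 1 \<rho> * tstep t (i + 1)"
        using tstep_pos[of "i + 1"] i' by (intro mult_right_mono) auto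
      then show ?thesis using \<rho>[of i] i' by auto
    qed
    ultimately have "d i \<le> max 1 \<rho> * tstep t (i + 1) * omega \<gamma> z"
      unfolding d_def using tstep_pos[of i] tstep_pos[of "i + 1"] i' \<gamma>
      by (intro mult_mono) (auto intro!: mult_nonneg_nonneg omega_nonneg)
    then show "d i \<le> max 1 \<rho> * (omega (\<gamma> + 1) (t (i + 1)) - omega (\<gamma> + 1) (t i))"
      unfolding z(3) by (simp add: tstep_def)
  qed
  \<comment> \<open>The comparison with the next cell shifts the telescoping sum by one index: it
    runs from \<open>t 1\<close> to \<open>t n\<close> and still stays within the mesh.\<close>
  also have "\<dots> = max 1 \<rho> * (omega (\<gamma> + 1) (t n) - omega (\<gamma> + 1) (t 1))"
  proof -
    have "(\<Sum>i = 1..m. f (i + 1) - f i) = f (m + 1) - f 1" for f :: "nat \<Rightarrow> real" and m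
      by (induction m) auto
    from this[of "\<lambda>i. omega (\<gamma> + 1) (t i)" "n - 1"] show ?thesis
      unfolding sum_distrib_left[symmetric] using n by simp
  qed
  also have "\<dots> \<le> max 1 \<rho> * omega (\<gamma> + 1) (t n)"
    using \<gamma> omega_nonneg[of "\<gamma> + 1" "t 1"] by (intro mult_left_mono) auto
  finally show ?thesis .
next
  case False
  \<comment> \<open>For \<open>\<gamma> < 1\<close> the Chebyshev bound gives the increment on the
    same cell, so the \<open>d i\<close> telescope without any step ratio.\<close>
  define d where "d i = omega (\<gamma> + 1) (t i) - omega (\<gamma> + 1) (t (i - 1))" for i
  have "(\<Sum>j = 1..n - 1. P n j * omega (1 - \<alpha> + \<gamma>) (t j)) \<le> (\<Sum>i = 1..n - 1. d i)"
  proof (rule sum_P_omega_le_sum[OF n \<gamma>])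
    show "0 \<le> d i" if "1 \<le> i" "i < n" for i
      using omega_mono[of "\<gamma> + 1" "t (i - 1)" "t i"] t_nonneg[of "i - 1"] t_step[of i] that n \<gamma>
      by (simp add: d_def)
    fix i j assume ij: "1 \<le> i" "i \<le> j" "j < n"
    have "(t i - t (i - 1)) * integral {t (i - 1)..t i} (\<lambda>s. omega (1 - \<alpha>) (t j - s) * omega \<gamma> s) \<le>
        integral {t (i - 1)..t i} (\<lambda>s. omega (1 - \<alpha>) (t j - s)) *
          (omega (\<gamma> + 1) (t i) - omega (\<gamma> + 1) (t (i - 1)))"
      by (rule convolution_integral_le_concave)
        (use \<alpha> \<gamma> False ij n t_nonneg t_step t_mono in auto)
    also have "integral {t (i - 1)..t i} (\<lambda>s. omega (1 - \<alpha>) (t j - s)) = tstep t i * A j i"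
      using tstep_times_A[of i j] ij n by simp
    finally have "tstep t i * integral {t (i - 1)..t i} (\<lambda>s. omega (1 - \<alpha>) (t j - s) * omega \<gamma> s) \<le>
        tstep t i * (A j i * d i)"
      unfolding d_def tstep_def by (simp only: mult.assoc)
    then show "integral {t (i - 1)..t i} (\<lambda>s. omega (1 - \<alpha>) (t j - s) * omega \<gamma> s) \<le> A j i * d i"
      using tstep_pos[of i] ij n by simp
  qed
  also have "\<dots> = omega (\<gamma> + 1) (t (n - 1))"
  proof -
    have "(\<Sum>i = 1..m. d i) = omega (\<gamma> + 1) (t m)" for m
      by (induction m) (auto simp: d_def t0)
    then show ?thesis .
  qed
  also have "\<dots> \<le> 1 * omega (\<gamma> + 1) (t n)"
    using omega_mono[of "\<gamma> + 1" "t (n - 1)" "t n"] t_nonneg[of "n - 1"] t_mono[of "n - 1" n] n \<gamma> by simp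
  also have "\<dots> \<le> max 1 \<rho> * omega (\<gamma> + 1) (t n)"
    using \<gamma> by (intro mult_right_mono omega_nonneg) auto
  finally show ?thesis .
qed

text \<open>Both sides are expanded in powers of \<open>\<mu>\<close> and compared termwise by
  \<open>sum_P_omega_le\<close> with \<open>\<gamma> = (k + 1) * \<alpha>\<close>. Term
  \<open>k\<close> on the left meets term \<open>k + 1\<close> on the right, which accounts for the
  factor \<open>\<mu>\<close> and the subtracted \<open>1\<close>.\<close>

lemma sum_P_mittag_leffler_le:
  assumes n: "1 \<le> n" "n \<le> N" and \<mu>: "0 \<le> \<mu>"
    and \<rho>: "\<And>k. 1 \<le> k \<Longrightarrow> k < N \<Longrightarrow> tstep t k \<le> \<rho> * tstep t (k + 1)"
  shows "\<mu> * (\<Sum>j = 1..n - 1. P n j * mittag_leffler \<alpha> (\<mu> * t j powr \<alpha>))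
      \<le> max 1 \<rho> * (mittag_leffler \<alpha> (\<mu> * t n powr \<alpha>) - 1)"
proof -
  let ?E = "\<lambda>j. mittag_leffler \<alpha> (\<mu> * t j powr \<alpha>)"
  have E: "(\<lambda>k. \<mu> ^ k * omega (1 + real k * \<alpha>) (t j)) sums ?E j" if "1 \<le> j" "j \<le> N" for j
  proof -
    have "(\<mu> * t j powr \<alpha>) ^ k / Gamma (1 + real k * \<alpha>) = \<mu> ^ k * omega (1 + real k * \<alpha>) (t j)" for k
      using t_pos[OF that] by (simp add: omega_def power_mult_distrib powr_power mult.commute)
    then show ?thesis
      using mittag_leffler_sums[OF \<alpha>(1), of "\<mu> * t j powr \<alpha>"] by simp
  qed
  have L: "(\<lambda>k. \<mu> * (\<Sum>j = 1..n - 1. P n j * (\<mu> ^ k * omega (1 + real k * \<alpha>) (t j))))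
      sums (\<mu> * (\<Sum>j = 1..n - 1. P n j * ?E j))"
    using n by (intro sums_mult sums_sum E) auto
  have "(\<lambda>k. \<mu> ^ Suc k * omega (1 + real (Suc k) * \<alpha>) (t n)) sums
      (?E n - \<mu> ^ 0 * omega (1 + real 0 * \<alpha>) (t n))"
    using E[OF n] by (subst sums_Suc_iff) simp
  moreover have "omega 1 (t n) = 1"
    using t_pos[OF n] by (simp add: omega_def)
  ultimately have "(\<lambda>k. max 1 \<rho> * (\<mu> ^ Suc k * omega (1 + real (Suc k) * \<alpha>) (t n))) sums
      (max 1 \<rho> * (?E n - 1))"
    by (intro sums_mult) simp
  then show ?thesis
  proof (rule sums_le[OF _ L, rotated])
    fix k
    have "(\<Sum>j = 1..n - 1. P n j * omega (1 - \<alpha> + real (Suc k) * \<alpha>) (t j))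
        \<le> max 1 \<rho> * omega (real (Suc k) * \<alpha> + 1) (t n)"
      by (rule sum_P_omega_le[OF n _ \<rho>]) (use \<alpha> in auto)
    moreover have "1 - \<alpha> + real (Suc k) * \<alpha> = 1 + real k * \<alpha>"
      by (simp add: algebra_simps)
    ultimately have "\<mu> ^ Suc k * (\<Sum>j = 1..n - 1. P n j * omega (1 + real k * \<alpha>) (t j))
        \<le> \<mu> ^ Suc k * (max 1 \<rho> * omega (real (Suc k) * \<alpha> + 1) (t n))"
      using \<mu> by (intro mult_left_mono zero_le_power) (simp_all only:)
    moreover have "\<mu> * (\<Sum>j = 1..n - 1. P n j * (\<mu> ^ k * omega (1 + real k * \<alpha>) (t j))) =
        \<mu> ^ Suc k * (\<Sum>j = 1..n - 1. P n j * omega (1 + real k * \<alpha>) (t j))"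
      unfolding power_Suc sum_distrib_left by (simp only: ac_simps)
    ultimately show "\<mu> * (\<Sum>j = 1..n - 1. P n j * (\<mu> ^ k * omega (1 + real k * \<alpha>) (t j)))
        \<le> max 1 \<rho> * (\<mu> ^ Suc k * omega (1 + real (Suc k) * \<alpha>) (t n))"
      by (simp only: ac_simps)
  qed
qed

text \<open>Since \<open>Gamma\<close> is at most \<open>1\<close> on \<open>[1, 2]\<close>, the step restriction lets the first-order growth of the
  Mittag-Leffler function absorb the implicit term \<open>q * P n n * w n\<close>, so that no constant factor is lost.\<close>

lemma discrete_gronwall:
  assumes \<rho>: "\<And>k. 1 \<le> k \<Longrightarrow> k < N \<Longrightarrow> tstep t k \<le> \<rho> * tstep t (k + 1)"
    and q: "0 \<le> q"
    and small: "\<And>k. 1 \<le> k \<Longrightarrow> k \<le> N \<Longrightarrow> 4 * q * (Gamma (2 - \<alpha>) * tstep t k powr \<alpha>) \<le> 1"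
    and w: "\<And>n. 1 \<le> n \<Longrightarrow> n \<le> N \<Longrightarrow> L1_deriv \<alpha> t w n \<le> q * w n + g n"
    and B: "\<And>n. 1 \<le> n \<Longrightarrow> n \<le> N \<Longrightarrow> (\<Sum>j = 1..n. P n j * g j) \<le> B"
    and C: "0 \<le> w 0 + B"
    and n: "1 \<le> n" "n \<le> N"
  shows "w n \<le> mittag_leffler \<alpha> (4 * q * max 1 \<rho> * t n powr \<alpha>) * (w 0 + B)"
  using n
proof (induction n rule: less_induct)
  case (less n)
  \<comment> \<open>The factor \<open>max 1 \<rho>\<close> in \<open>\<mu>\<close> cancels the one
    in \<open>sum_P_mittag_leffler_le\<close>; the factor \<open>4\<close> leaves
    \<open>q * S\<close> at most a quarter of \<open>e - 1\<close>.\<close>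
  define \<mu> where "\<mu> = 4 * q * max 1 \<rho>"
  define C where "C = w 0 + B"
  let ?E = "\<lambda>j. mittag_leffler \<alpha> (\<mu> * t j powr \<alpha>)"
  define S where "S = (\<Sum>j = 1..n - 1. P n j * ?E j)"
  define e where "e = ?E n"
  have \<mu>: "0 \<le> \<mu>" using q by (simp add: \<mu>_def)
  have C0: "0 \<le> C" using C by (simp add: C_def)
  have "max 1 \<rho> * (4 * q * S) \<le> max 1 \<rho> * (e - 1)"
    using sum_P_mittag_leffler_le[OF less.prems \<mu> \<rho>] unfolding e_def S_def by (simp add: \<mu>_def ac_simps)
  then have S: "4 * q * S \<le> e - 1"
    by (simp add: mult_le_cancel_left)
  \<comment> \<open>\<open>x\<close> is \<open>q * P n n\<close>, the coefficient of the implicit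
    term.\<close>
  define x where "x = q * (Gamma (2 - \<alpha>) * tstep t n powr \<alpha>)"
  have x: "0 \<le> x" "x \<le> 1 / 4"
    using small[OF less.prems] q \<alpha> unfolding x_def by (auto intro!: mult_nonneg_nonneg)
  have "1 + 4 * x \<le> e"
  proof -
    let ?y = "\<mu> * t n powr \<alpha>"
    have "1 * tstep t n powr \<alpha> \<le> max 1 \<rho> * t n powr \<alpha>"
      using tstep_le[OF less.prems] tstep_pos[OF less.prems] \<alpha> by (intro mult_mono powr_mono2) auto
    then have y: "4 * q * tstep t n powr \<alpha> \<le> ?y"
      unfolding \<mu>_def mult.assoc using q by (intro mult_left_mono) auto
    have "4 * x = 4 * q * tstep t n powr \<alpha> * Gamma (2 - \<alpha>)"
      by (simp add: x_def)
    also have "\<dots> \<le> 4 * q * tstep t n powr \<alpha> * 1"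
      using q \<alpha> by (intro mult_left_mono Gamma_le_1) auto
    also have "\<dots> \<le> ?y" using y by simp
    also have "\<dots> \<le> ?y / Gamma (1 + \<alpha>)"
      using Gamma_le_1[of "1 + \<alpha>"] Gamma_real_pos[of "1 + \<alpha>"] \<alpha> \<mu> by (simp add: pos_le_divide_eq mult_left_le)
    also have "1 + \<dots> \<le> e"
      unfolding e_def using \<alpha> \<mu> by (intro mittag_leffler_ge) auto
    finally show ?thesis by simp
  qed
  have "w n - w 0 = (\<Sum>j = 1..n. P n j * L1_deriv \<alpha> t w j)"
    using sum_P_L1_deriv[OF less.prems] by simp
  also have "\<dots> \<le> (\<Sum>j = 1..n. P n j * (q * w j + g j))"
    using w less.prems by (intro sum_mono mult_left_mono P_nonneg) auto
  also have "\<dots> = q * (\<Sum>j = 1..n. P n j * w j) + (\<Sum>j = 1..n. P n j * g j)"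
    by (simp add: distrib_left sum.distrib sum_distrib_left ac_simps)
  also have "(\<Sum>j = 1..n. P n j * g j) \<le> B" by (rule B[OF less.prems])
  also have "(\<Sum>j = 1..n. P n j * w j) = (\<Sum>j = 1..n - 1. P n j * w j) + P n n * w n"
    using less.prems by (cases n) auto
  finally have "w n \<le> C + q * (\<Sum>j = 1..n - 1. P n j * w j) + q * P n n * w n"
    by (simp add: C_def algebra_simps)
  moreover have "q * P n n * w n = x * w n"
    unfolding P_diag A_diag[OF less.prems] by (simp add: x_def)
  moreover have "q * (\<Sum>j = 1..n - 1. P n j * w j) \<le> q * (S * C)"
    unfolding S_def sum_distrib_right mult.assoc using less q
    by (intro mult_left_mono sum_mono P_nonneg) (auto simp: \<mu>_def C_def ac_simps)
  ultimately have "w n \<le> C + q * (S * C) + x * w n"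
    by linarith
  then have "w n * (1 - x) \<le> (1 + q * S) * C"
    by (simp add: algebra_simps)
  also have "\<dots> \<le> (e * (1 - x)) * C"
  proof (intro mult_right_mono C0)
    \<comment> \<open>Inserting \<open>q * S \<le> (e - 1) / 4\<close>, it remains to see that
      \<open>3 / 4 \<le> e * (3 / 4 - x)\<close>. This follows from \<open>1 + 4 * x \<le> e\<close>
      and \<open>0 \<le> x \<le> 1 / 4\<close>.\<close>
    have "0 \<le> (e - 1 - 4 * x) * (3 / 4 - x)" "0 \<le> x * (1 / 4 - x)"
      using \<open>1 + 4 * x \<le> e\<close> x by (auto intro!: mult_nonneg_nonneg)
    moreover have "(e - 1 - 4 * x) * (3 / 4 - x) = 3 / 4 * e - e * x - 3 / 4 - 2 * x + 4 * x\<^sup>2"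
      "x * (1 / 4 - x) = x / 4 - x\<^sup>2" "e * (1 - x) = e - e * x"
      by (simp_all add: algebra_simps power2_eq_square)
    moreover have "4 * (q * S) \<le> e - 1" using S by simp
    ultimately show "1 + q * S \<le> e * (1 - x)"
      using x(1) by linarith
  qed
  finally have "w n * (1 - x) \<le> (e * C) * (1 - x)" by (simp add: ac_simps)
  then have "w n \<le> e * C" using x by (simp add: mult_le_cancel_right)
  then show ?case by (simp add: e_def C_def \<mu>_def)
qed

section \<open>From the energy inequality to a linear inequality\<close>

lemma sum_P_le:
  assumes n: "1 \<le> n" "n \<le> N" and K: "0 \<le> K"
    and g: "\<And>j. 1 \<le> j \<Longrightarrow> j \<le> n \<Longrightarrow> g j \<le> omega (1 - \<alpha>) (t j) * K"
  shows "(\<Sum>j = 1..n. P n j * g j) \<le> K"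
proof -
  have "(\<Sum>j = 1..n. P n j * g j) \<le> (\<Sum>j = 1..n. P n j * (omega (1 - \<alpha>) (t j) * K))"
    using n g by (intro sum_mono mult_left_mono P_nonneg) auto
  also have "\<dots> = (\<Sum>j = 1..n. P n j * omega (1 - \<alpha>) (t j)) * K"
    unfolding sum_distrib_right by (simp only: ac_simps)
  also have "\<dots> \<le> 1 * K"
    using sum_P_omega_le_1[OF n] K by (rule mult_right_mono)
  finally show ?thesis by simp
qed

lemma omega_Gamma_powr:
  assumes "1 \<le> n" "n \<le> N"
  shows "omega (1 - \<alpha>) (t n) * (Gamma (1 - \<alpha>) * t n powr \<alpha>) = 1"
  using \<alpha> t_pos[OF assms] less_imp_neq[OF Gamma_real_pos[of "1 - \<alpha>"]]
  by (simp add: omega_def powr_minus field_simps)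

text \<open>The maximum with \<open>G\<close> makes division by \<open>w n\<close> possible: where \<open>w n \<le> G\<close> the maximum is minimal,
  so its discrete derivative is nonpositive, and elsewhere \<open>\<epsilon>^2 \<le> omega (1 - \<alpha>) (t n) * G * w n\<close>.\<close>

lemma L1_deriv_max_le:
  assumes n: "1 \<le> n" "n \<le> N" and pos: "0 \<le> q" "0 \<le> g" "0 \<le> c" "0 \<le> \<epsilon>"
    and energy: "w n * L1_deriv \<alpha> t w n \<le> q * (w n)\<^sup>2 + g * w n + c * \<epsilon>\<^sup>2"
    and G: "sqrt (Gamma (1 - \<alpha>)) * (t n powr (\<alpha> / 2) * \<epsilon>) \<le> G"
  shows "L1_deriv \<alpha> t (\<lambda>k. max (w k) G) n \<le>
      q * max (w n) G + (g + c * (omega (1 - \<alpha>) (t n) * G))"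
proof -
  have G0: "0 \<le> G"
    using order_trans[OF _ G, of 0] \<alpha> pos by simp
  have om: "0 \<le> omega (1 - \<alpha>) (t n)"
    using \<alpha> by (simp add: omega_nonneg)
  show ?thesis
  proof (cases "w n \<le> G")
    case True
    then have "L1_deriv \<alpha> t (\<lambda>k. max (w k) G) n \<le> 0"
      by (intro L1_deriv_nonpos n) auto
    also have "0 \<le> q * max (w n) G + (g + c * (omega (1 - \<alpha>) (t n) * G))"
      using pos G0 om by (intro add_nonneg_nonneg mult_nonneg_nonneg) auto
    finally show ?thesis .
  next
    case False
    then have wn: "0 < w n" using G0 by simp
    define s where "s = sqrt (Gamma (1 - \<alpha>)) * t n powr (\<alpha> / 2)"
    have s0: "0 \<le> s" using \<alpha> by (simp add: s_def)
    have "s\<^sup>2 = Gamma (1 - \<alpha>) * t n powr \<alpha>"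
      using \<alpha> t_pos[OF n] by (simp add: s_def power_mult_distrib powr_power)
    then have "omega (1 - \<alpha>) (t n) * s\<^sup>2 = 1"
      using omega_Gamma_powr[OF n] by simp
    then have "\<epsilon>\<^sup>2 = omega (1 - \<alpha>) (t n) * ((s * \<epsilon>) * (s * \<epsilon>))"
      by (simp add: power2_eq_square ac_simps)
    also have "\<dots> \<le> omega (1 - \<alpha>) (t n) * (G * w n)"
      using G False s0 pos G0 om by (intro mult_left_mono mult_mono) (auto simp: s_def ac_simps)
    finally have "c * \<epsilon>\<^sup>2 \<le> c * (omega (1 - \<alpha>) (t n) * (G * w n))"
      using pos by (intro mult_left_mono)
    with energy have "w n * L1_deriv \<alpha> t w n \<le>
        w n * (q * w n + (g + c * (omega (1 - \<alpha>) (t n) * G)))"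
      by (simp add: power2_eq_square algebra_simps)
    then have "L1_deriv \<alpha> t w n \<le> q * w n + (g + c * (omega (1 - \<alpha>) (t n) * G))"
      using wn by simp
    \<comment> \<open>The maximum leaves the value at level \<open>n\<close> unchanged and can only
      raise earlier values, so the comparison principle applies.\<close>
    moreover have "L1_deriv \<alpha> t (\<lambda>k. max (w k) G) n \<le> L1_deriv \<alpha> t w n"
      using False by (intro L1_deriv_antimono n) auto
    ultimately show ?thesis using False by simp
  qed
qed
end

section \<open>The spatial energy\<close>

lemma avg_L1_deriv:
  "avg M (\<lambda>j. L1_deriv \<alpha> t (\<lambda>k. u k j) n) i = L1_deriv \<alpha> t (\<lambda>k. avg M (u k) i) n"
  by (simp add: avg_def L1_deriv_def sum.distrib sum_distrib_left algebra_simps flip: sum.distrib)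

text \<open>A discrete Green identity. At interior nodes \<open>avg\<close> is the identity plus
  \<open>h\<^sup>2 / 12\<close> times \<open>dxx\<close>, so the products of two second differences
  cancel and a telescoping difference remains.\<close>

lemma sum_dxx_avg:
  assumes h: "h \<noteq> 0" and M: "1 \<le> M" and u: "u 0 = 0" "u M = 0"
  shows "(\<Sum>i = 1..M - 1. dxx h M v i * avg M u i) =
      (\<Sum>i = 1..M - 1. avg M v i * dxx h M u i) + (v 0 * dxx h M u 0 + v M * dxx h M u M) / 2"
proof -
  \<comment> \<open>\<open>F\<close> is a discrete Wronskian. With \<open>u\<close> zero at both
    ends, its end values are the boundary rows of \<open>dxx\<close>, halved.\<close>
  define F where "F i = (v (i + 1) * u i - v i * u (i + 1)) / h\<^sup>2" for i
  have "dxx h M v i * avg M u i - avg M v i * dxx h M u i = F i - F (i - 1)" if "i \<in> {1..M - 1}" for i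
    using that M h by (cases "i = M") (simp_all add: dxx_def dx_def avg_def F_def power2_eq_square field_simps)
  then have "(\<Sum>i = 1..M - 1. dxx h M v i * avg M u i) - (\<Sum>i = 1..M - 1. avg M v i * dxx h M u i)
      = (\<Sum>i = 1..M - 1. F i - F (i - 1))"
    by (simp add: sum_subtractf[symmetric])
  also have "\<dots> = F (M - 1) - F 0"
  proof -
    have "(\<Sum>i = 1..m. F i - F (i - 1)) = F m - F 0" for m
      by (induction m) auto
    then show ?thesis .
  qed
  also have "\<dots> = (v 0 * dxx h M u 0 + v M * dxx h M u M) / 2"
    using h M u by (simp add: F_def dxx_def dx_def power2_eq_square field_simps)
  finally show ?thesis by (simp only: diff_eq_eq add.commute)
qed

text \<open>Products of neighbouring interior values are counted twice and bounded below by minus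
  the sum of their squares; the two products with end values stay exact. The extra
  \<open>(v m)\<^sup>2\<close> strengthens the claim for the induction.\<close>

lemma sum_neighbours_ge:
  fixes v :: "nat \<Rightarrow> real"
  assumes "1 \<le> m"
  shows "v 0 * v 1 + v m * v (m + 1) - 2 * (\<Sum>i = 1..m. (v i)\<^sup>2) + (v m)\<^sup>2
      \<le> (\<Sum>i = 1..m. v (i - 1) * v i + v i * v (i + 1))"
  using assms
proof (induction m rule: nat_induct_at_least)
  case base
  then show ?case by simp
next
  case (Suc m)
  have "0 \<le> (v m + v (Suc m))\<^sup>2" by simp
  then have "0 \<le> (v m)\<^sup>2 + 2 * (v m * v (Suc m)) + (v (Suc m))\<^sup>2"
    by (simp add: power2_eq_square algebra_simps)
  with Suc show ?case by simp
qed

text \<open>The coefficient is \<open>10 / 12 - 2 / 12\<close>, the neighbour products costing at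
  most twice the sum of squares. The end products keep their sign for later use.\<close>

lemma sum_avg_mult_ge:
  assumes "2 \<le> M"
  shows "2 / 3 * (\<Sum>i = 1..M - 1. (v i)\<^sup>2) + (v 0 * v 1 + v M * v (M - 1)) / 12
      \<le> (\<Sum>i = 1..M - 1. avg M v i * v i)"
proof -
  have "(\<Sum>i = 1..M - 1. avg M v i * v i) =
      (\<Sum>i = 1..M - 1. 10 / 12 * (v i)\<^sup>2 + (v (i - 1) * v i + v i * v (i + 1)) / 12)"
    using assms by (intro sum.cong) (auto simp: avg_def power2_eq_square field_simps)
  also have "\<dots> = 10 / 12 * (\<Sum>i = 1..M - 1. (v i)\<^sup>2) +
      (\<Sum>i = 1..M - 1. v (i - 1) * v i + v i * v (i + 1)) / 12"
    unfolding sum.distrib[where g = "\<lambda>i. 10 / 12 * (v i)\<^sup>2"] sum_distrib_left sum_divide_distrib ..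
  finally have *: "(\<Sum>i = 1..M - 1. avg M v i * v i) = 10 / 12 * (\<Sum>i = 1..M - 1. (v i)\<^sup>2) +
      (\<Sum>i = 1..M - 1. v (i - 1) * v i + v i * v (i + 1)) / 12" .
  have "v 0 * v 1 + v M * v (M - 1) - 2 * (\<Sum>i = 1..M - 1. (v i)\<^sup>2) + (v (M - 1))\<^sup>2
      \<le> (\<Sum>i = 1..M - 1. v (i - 1) * v i + v i * v (i + 1))"
    using sum_neighbours_ge[of "M - 1" v] assms by (simp add: mult.commute[of "v M"])
  then have "v 0 * v 1 + v M * v (M - 1) - 2 * (\<Sum>i = 1..M - 1. (v i)\<^sup>2)
      \<le> (\<Sum>i = 1..M - 1. v (i - 1) * v i + v i * v (i + 1))"
    using zero_le_power2[of "v (M - 1)"] by linarith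
  then show ?thesis
    unfolding * by (simp add: field_simps)
qed

text \<open>The factor \<open>2\<close> covers \<open>M = 2\<close>, where the two outermost
  interior nodes coincide.\<close>

lemma boundary_squares_le:
  fixes v :: "nat \<Rightarrow> real"
  assumes "2 \<le> M"
  shows "(v 1)\<^sup>2 + (v (M - 1))\<^sup>2 \<le> 2 * (\<Sum>i = 1..M - 1. (v i)\<^sup>2)"
proof -
  have "(v k)\<^sup>2 \<le> (\<Sum>i = 1..M - 1. (v i)\<^sup>2)" if "k \<in> {1..M - 1}" for k
    using that by (intro member_le_sum[where f = "\<lambda>i. (v i)\<^sup>2"]) auto
  moreover have "1 \<in> {1..M - 1}" "M - 1 \<in> {1..M - 1}" using assms by auto
  ultimately have "(v 1)\<^sup>2 \<le> (\<Sum>i = 1..M - 1. (v i)\<^sup>2)" "(v (M - 1))\<^sup>2 \<le> (\<Sum>i = 1..M - 1. (v i)\<^sup>2)"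
    by blast+
  then show ?thesis by linarith
qed

text \<open>The compact averaging is not self-adjoint for the discrete inner product because of its boundary
  rows, so the energy is expanded in \<open>v\<close>: it is a quadratic form in \<open>v\<close> minus a term linear in \<open>\<eta>\<close>, and the
  form dominates a third of the sum of squares that bounds the linear term.\<close>

lemma avg_form_ge:
  assumes "2 \<le> M"
  shows "((\<Sum>i = 1..M - 1. (avg M v i)\<^sup>2) + (v 0)\<^sup>2 / 2 + (v M)\<^sup>2 / 2) / 3
      \<le> (\<Sum>i = 1..M - 1. (avg M v i)\<^sup>2) + (v 0 * avg M v 0 + v M * avg M v M) / 2"
proof -
  define S where "S = (\<Sum>i = 1..M - 1. (v i)\<^sup>2)"
  have "(\<Sum>i = 1..M - 1. 4 / 3 * (avg M v i * v i) - 4 / 9 * (v i)\<^sup>2) \<le> (\<Sum>i = 1..M - 1. (avg M v i)\<^sup>2)"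
  proof (rule sum_mono)
    fix i
    have "0 \<le> (avg M v i - 2 / 3 * v i)\<^sup>2" by simp
    then show "4 / 3 * (avg M v i * v i) - 4 / 9 * (v i)\<^sup>2 \<le> (avg M v i)\<^sup>2"
      by (simp add: power2_eq_square algebra_simps)
  qed
  then have "4 / 3 * (\<Sum>i = 1..M - 1. avg M v i * v i) - 4 / 9 * S \<le> (\<Sum>i = 1..M - 1. (avg M v i)\<^sup>2)"
    by (simp add: S_def sum_subtractf sum_distrib_left)
  moreover note sum_avg_mult_ge[OF assms, of v] boundary_squares_le[OF assms, of v]
  \<comment> \<open>Subtracting the third leaves \<open>8 / 27 * S\<close>, the end products with
    coefficient \<open>2 / 27 + 1 / 6 = 13 / 54\<close>, and a sixth of the end squares.
    \<open>boundary_squares_le\<close> gives each outermost interior square the weight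
    \<open>4 / 27\<close>, so one quadratic form per end remains.\<close>
  moreover have "0 \<le> 4 / 27 * y\<^sup>2 + 13 / 54 * (x * y) + x\<^sup>2 / 6" for x y :: real
  proof -
    have "0 \<le> (x / 3 + 13 / 36 * y)\<^sup>2" by simp
    then have "0 \<le> x\<^sup>2 / 9 + 26 / 108 * (x * y) + 169 / 1296 * y\<^sup>2"
      by (simp add: power2_eq_square algebra_simps)
    moreover have "0 \<le> x\<^sup>2" "0 \<le> y\<^sup>2" by auto
    ultimately show ?thesis by linarith
  qed
  from this[of "v 1" "v 0"] this[of "v (M - 1)" "v M"]
  have "0 \<le> 4 / 27 * ((v 1)\<^sup>2 + (v (M - 1))\<^sup>2) + 13 / 54 * (v 0 * v 1 + v M * v (M - 1))
      + ((v 0)\<^sup>2 + (v M)\<^sup>2) / 6"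
    by (simp add: algebra_simps add_divide_distrib)
  moreover have "v 0 * avg M v 0 = 2 / 3 * (v 0)\<^sup>2 + v 0 * v 1 / 3"
    "v M * avg M v M = 2 / 3 * (v M)\<^sup>2 + v M * v (M - 1) / 3"
    using assms by (simp_all add: avg_def power2_eq_square algebra_simps)
  ultimately show ?thesis
    unfolding S_def[symmetric] by (simp add: field_simps)
qed

lemma energy_ge:
  assumes h: "0 < h" and M: "1 \<le> M" and u: "u 0 = 0" "u M = 0"
    and v: "\<And>i. i \<le> M \<Longrightarrow> avg M v i = dxx h M u i + \<eta> i"
  shows "- (h * (\<Sum>i = 1..M - 1. dxx h M v i * avg M u i)) \<le> 3 / 4 * grid_inner h M \<eta> \<eta>"
proof (cases "M = 1")
  case True
  then show ?thesis using h by (simp add: grid_inner_def)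
next
  case False
  then have M2: "2 \<le> M" using M by simp
  let ?a = "avg M v"
  \<comment> \<open>Young's inequality with weight \<open>1 / 3\<close>, the share granted by
    \<open>avg_form_ge\<close>; this fixes the constant \<open>3 / 4\<close>. At the ends it is
    applied to \<open>v\<close> itself, not to its average.\<close>
  have AM: "a * e \<le> a\<^sup>2 / 3 + 3 / 4 * e\<^sup>2" for a e :: real
  proof -
    have "0 \<le> (2 / 3 * a - e)\<^sup>2" by simp
    then show ?thesis by (simp add: power2_eq_square algebra_simps)
  qed
  have d: "dxx h M u i = ?a i - \<eta> i" if "i \<le> M" for i
    using v[OF that] by simp
  have "(\<Sum>i = 1..M - 1. dxx h M v i * avg M u i) =
      (\<Sum>i = 1..M - 1. ?a i * (?a i - \<eta> i)) + (v 0 * (?a 0 - \<eta> 0) + v M * (?a M - \<eta> M)) / 2"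
    unfolding sum_dxx_avg[OF less_imp_neq[OF h, symmetric] M u] d[OF le0] d[OF order_refl]
    using d by (intro arg_cong2[where f = "(+)"] refl sum.cong) auto
  also have "\<dots> = ((\<Sum>i = 1..M - 1. (?a i)\<^sup>2) + (v 0 * ?a 0 + v M * ?a M) / 2)
      - (\<Sum>i = 1..M - 1. ?a i * \<eta> i) - v 0 * \<eta> 0 / 2 - v M * \<eta> M / 2"
    by (simp add: right_diff_distrib sum_subtractf power2_eq_square field_simps)
  finally have "- (\<Sum>i = 1..M - 1. dxx h M v i * avg M u i) =
      (\<Sum>i = 1..M - 1. ?a i * \<eta> i) + v 0 * \<eta> 0 / 2 + v M * \<eta> M / 2
      - ((\<Sum>i = 1..M - 1. (?a i)\<^sup>2) + (v 0 * ?a 0 + v M * ?a M) / 2)"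
    by simp
  moreover have "(\<Sum>i = 1..M - 1. ?a i * \<eta> i) \<le> (\<Sum>i = 1..M - 1. (?a i)\<^sup>2 / 3 + 3 / 4 * (\<eta> i)\<^sup>2)"
    by (intro sum_mono AM)
  then have "(\<Sum>i = 1..M - 1. ?a i * \<eta> i)
      \<le> (\<Sum>i = 1..M - 1. (?a i)\<^sup>2) / 3 + 3 / 4 * (\<Sum>i = 1..M - 1. (\<eta> i)\<^sup>2)"
    by (simp add: sum.distrib sum_distrib_left sum_divide_distrib)
  moreover note AM[of "v 0" "\<eta> 0"] AM[of "v M" "\<eta> M"] avg_form_ge[OF M2, of v]
  ultimately have "- (\<Sum>i = 1..M - 1. dxx h M v i * avg M u i) \<le>
      3 / 4 * ((\<eta> 0)\<^sup>2 / 2 + (\<Sum>i = 1..M - 1. (\<eta> i)\<^sup>2) + (\<eta> M)\<^sup>2 / 2)"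
    by (simp add: field_simps)
  then have "h * - (\<Sum>i = 1..M - 1. dxx h M v i * avg M u i) \<le>
      h * (3 / 4 * ((\<eta> 0)\<^sup>2 / 2 + (\<Sum>i = 1..M - 1. (\<eta> i)\<^sup>2) + (\<eta> M)\<^sup>2 / 2))"
    using h by (intro mult_left_mono) auto
  then show ?thesis
    by (simp add: grid_inner_def power2_eq_square algebra_simps)
qed

section \<open>Interior and full grid norms\<close>

definition interior_norm :: "real \<Rightarrow> nat \<Rightarrow> (nat \<Rightarrow> real) \<Rightarrow> real" where
  "interior_norm h M v = sqrt h * L2_set v {1..M - 1}"

lemma interior_norm_nonneg: "0 \<le> h \<Longrightarrow> 0 \<le> interior_norm h M v"
  by (simp add: interior_norm_def)

lemma interior_norm_power2: "0 \<le> h \<Longrightarrow> (interior_norm h M v)\<^sup>2 = h * (\<Sum>i = 1..M - 1. (v i)\<^sup>2)"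
  by (simp add: interior_norm_def power_mult_distrib L2_set_def sum_nonneg)

lemma grid_inner_self:
  "grid_inner h M v v = h * ((v 0)\<^sup>2 / 2 + (\<Sum>i = 1..M - 1. (v i)\<^sup>2) + (v M)\<^sup>2 / 2)"
  by (simp add: grid_inner_def power2_eq_square algebra_simps)

lemma grid_inner_nonneg: "0 \<le> h \<Longrightarrow> 0 \<le> grid_inner h M v v"
  unfolding grid_inner_self by (intro mult_nonneg_nonneg add_nonneg_nonneg sum_nonneg) auto

lemma grid_norm_nonneg: "0 \<le> h \<Longrightarrow> 0 \<le> grid_norm h M v"
  by (simp add: grid_norm_def grid_inner_nonneg)

lemma grid_norm_power2: "0 \<le> h \<Longrightarrow> (grid_norm h M v)\<^sup>2 = grid_inner h M v v"
  by (simp add: grid_norm_def grid_inner_nonneg)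

lemma interior_norm_le_grid_norm:
  assumes "0 \<le> h"
  shows "interior_norm h M v \<le> grid_norm h M v"
proof (rule power2_le_imp_le)
  have "h * (\<Sum>i = 1..M - 1. (v i)\<^sup>2) \<le> h * ((v 0)\<^sup>2 / 2 + (\<Sum>i = 1..M - 1. (v i)\<^sup>2) + (v M)\<^sup>2 / 2)"
    using assms by (intro mult_left_mono) auto
  then show "(interior_norm h M v)\<^sup>2 \<le> (grid_norm h M v)\<^sup>2"
    using assms by (simp add: interior_norm_power2 grid_norm_power2 grid_inner_self)
qed (use assms grid_norm_nonneg in auto)

lemma sum_interior_le:
  assumes "0 \<le> h"
  shows "h * (\<Sum>i = 1..M - 1. v i * w i) \<le> interior_norm h M v * grid_norm h M w"
proof -
  have "(\<Sum>i = 1..M - 1. v i * w i) \<le> (\<Sum>i = 1..M - 1. \<bar>v i\<bar> * \<bar>w i\<bar>)"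
    by (intro sum_mono) (simp add: abs_mult[symmetric])
  also have "\<dots> \<le> L2_set v {1..M - 1} * L2_set w {1..M - 1}"
    by (rule L2_set_mult_ineq)
  finally have "h * (\<Sum>i = 1..M - 1. v i * w i) \<le> h * (L2_set v {1..M - 1} * L2_set w {1..M - 1})"
    using assms by (intro mult_left_mono)
  also have "\<dots> = (sqrt h * sqrt h) * (L2_set v {1..M - 1} * L2_set w {1..M - 1})"
    using assms by simp
  also have "\<dots> = interior_norm h M v * interior_norm h M w"
    unfolding interior_norm_def by (simp only: ac_simps)
  also have "\<dots> \<le> interior_norm h M v * grid_norm h M w"
    using assms by (intro mult_left_mono interior_norm_le_grid_norm interior_norm_nonneg)
  finally show ?thesis .
qed

text \<open>The boundary rows of \<open>avg\<close> are \<open>u 1 / 3\<close> and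
  \<open>u (M - 1) / 3\<close>. Their halved squares add at most \<open>S / 9 \<le> a / 4\<close>,
  and \<open>5 / 4 \<le> (8 / 7)\<^sup>2\<close>.\<close>

lemma grid_norm_avg_le:
  assumes h: "0 \<le> h" and M: "1 \<le> M" and u: "u 0 = 0" "u M = 0"
  shows "grid_norm h M (avg M u) \<le> 8 / 7 * interior_norm h M (avg M u)"
proof (cases "M = 1")
  case True
  then show ?thesis
    using u by (simp add: grid_norm_def grid_inner_def avg_def interior_norm_def)
next
  case False
  then have M2: "2 \<le> M" using M by simp
  define a where "a = (\<Sum>i = 1..M - 1. (avg M u i)\<^sup>2)"
  define S where "S = (\<Sum>i = 1..M - 1. (u i)\<^sup>2)"
  have "(\<Sum>i = 1..M - 1. avg M u i * u i) \<le> (\<Sum>i = 1..M - 1. 3 / 4 * (avg M u i)\<^sup>2 + (u i)\<^sup>2 / 3)"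
  proof (rule sum_mono)
    fix i
    have "0 \<le> (3 / 2 * avg M u i - u i)\<^sup>2" by simp
    then show "avg M u i * u i \<le> 3 / 4 * (avg M u i)\<^sup>2 + (u i)\<^sup>2 / 3"
      by (simp add: power2_eq_square algebra_simps)
  qed
  also have "\<dots> = 3 / 4 * a + S / 3"
    by (simp add: a_def S_def sum.distrib sum_distrib_left sum_divide_distrib)
  finally have "S \<le> 9 / 4 * a"
    using sum_avg_mult_ge[OF M2, of u] u by (simp add: S_def)
  moreover have "(u 1)\<^sup>2 + (u (M - 1))\<^sup>2 \<le> 2 * S"
    unfolding S_def by (rule boundary_squares_le[OF M2])
  moreover have "(avg M u 0)\<^sup>2 = (u 1)\<^sup>2 / 9" "(avg M u M)\<^sup>2 = (u (M - 1))\<^sup>2 / 9"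
    using u M2 by (simp_all add: avg_def power2_eq_square)
  moreover have "0 \<le> a" unfolding a_def by (intro sum_nonneg) auto
  ultimately have "(avg M u 0)\<^sup>2 / 2 + a + (avg M u M)\<^sup>2 / 2 \<le> 64 / 49 * a"
    by linarith
  then have "h * ((avg M u 0)\<^sup>2 / 2 + a + (avg M u M)\<^sup>2 / 2) \<le> h * (64 / 49 * a)"
    using h by (intro mult_left_mono)
  then have "(grid_norm h M (avg M u))\<^sup>2 \<le> (8 / 7 * interior_norm h M (avg M u))\<^sup>2"
    unfolding power_mult_distrib grid_norm_power2[OF h] interior_norm_power2[OF h] grid_inner_self a_def
    by (simp add: power2_eq_square)
  then show ?thesis
    by (rule power2_le_imp_le) (use h interior_norm_nonneg in auto)
qed

section \<open>Stability\<close>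

context L1_mesh
begin

text \<open>The evolution equation is tested at interior nodes only, but the equation for
  \<open>v\<close> is also used at both end nodes, because of the boundary terms in the Green
  identity.\<close>

lemma energy_estimate:
  assumes h: "0 < h" and M: "1 \<le> M" and n: "1 \<le> n" "n \<le> N"
    and u: "u n 0 = 0" "u n M = 0"
    and eq_u: "\<And>i. i \<in> {1..M - 1} \<Longrightarrow> avg M (\<lambda>j. L1_deriv \<alpha> t (\<lambda>k. u k j) n) i =
      - dxx h M (v n) i + q * avg M (u n) i + \<xi> n i + \<zeta> n i"
    and eq_v: "\<And>i. i \<le> M \<Longrightarrow> avg M (v n) i = dxx h M (u n) i + \<eta> n i"
  defines "w \<equiv> \<lambda>k. interior_norm h M (avg M (u k))"
  shows "w n * L1_deriv \<alpha> t w n \<le>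
      max q 0 * (w n)\<^sup>2 + (grid_norm h M (\<xi> n) + grid_norm h M (\<zeta> n)) * w n
      + 3 / 4 * (grid_norm h M (\<eta> n))\<^sup>2"
proof -
  let ?I = "{1..M - 1}"
  let ?y = "\<lambda>k. avg M (u k)"
  have "L1_deriv \<alpha> t w n = sqrt h * L1_deriv \<alpha> t (\<lambda>k. L2_set (?y k) ?I) n"
    by (simp add: w_def interior_norm_def L1_deriv_def sum_distrib_left algebra_simps)
  then have "w n * L1_deriv \<alpha> t w n = (sqrt h * sqrt h) *
      (L2_set (?y n) ?I * L1_deriv \<alpha> t (\<lambda>k. L2_set (?y k) ?I) n)"
    unfolding w_def interior_norm_def by (simp only: ac_simps)
  also have "\<dots> = h * (L2_set (?y n) ?I * L1_deriv \<alpha> t (\<lambda>k. L2_set (?y k) ?I) n)"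
    using h by simp
  also have "\<dots> \<le> h * (\<Sum>i\<in>?I. ?y n i * L1_deriv \<alpha> t (\<lambda>k. ?y k i) n)"
    using h by (intro mult_left_mono L2_set_L1_deriv_le[OF n]) auto
  also have "(\<Sum>i\<in>?I. ?y n i * L1_deriv \<alpha> t (\<lambda>k. ?y k i) n) =
      (\<Sum>i\<in>?I. - (dxx h M (v n) i * ?y n i) + q * (?y n i)\<^sup>2 + ?y n i * \<xi> n i + ?y n i * \<zeta> n i)"
  proof (intro sum.cong refl)
    fix i assume "i \<in> ?I"
    then have eq: "L1_deriv \<alpha> t (\<lambda>k. ?y k i) n = - dxx h M (v n) i + q * ?y n i + \<xi> n i + \<zeta> n i"
      using eq_u[of i] by (simp only: avg_L1_deriv)
    show "?y n i * L1_deriv \<alpha> t (\<lambda>k. ?y k i) n =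
        - (dxx h M (v n) i * ?y n i) + q * (?y n i)\<^sup>2 + ?y n i * \<xi> n i + ?y n i * \<zeta> n i"
      unfolding eq by (simp add: power2_eq_square algebra_simps)
  qed
  also have "h * \<dots> = - (h * (\<Sum>i\<in>?I. dxx h M (v n) i * ?y n i)) + q * (w n)\<^sup>2
      + h * (\<Sum>i\<in>?I. ?y n i * \<xi> n i) + h * (\<Sum>i\<in>?I. ?y n i * \<zeta> n i)"
    unfolding w_def interior_norm_power2[OF less_imp_le[OF h]] sum.distrib sum_negf sum_distrib_left[symmetric]
    by (simp add: algebra_simps)
  also have "- (h * (\<Sum>i\<in>?I. dxx h M (v n) i * ?y n i)) \<le> 3 / 4 * grid_inner h M (\<eta> n) (\<eta> n)"
    by (rule energy_ge[where v = "v n" and u = "u n", OF h M u eq_v])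
  also have "q * (w n)\<^sup>2 \<le> max q 0 * (w n)\<^sup>2"
    by (intro mult_right_mono) auto
  also have "h * (\<Sum>i\<in>?I. ?y n i * \<xi> n i) \<le> w n * grid_norm h M (\<xi> n)"
    unfolding w_def using h by (intro sum_interior_le) auto
  also have "h * (\<Sum>i\<in>?I. ?y n i * \<zeta> n i) \<le> w n * grid_norm h M (\<zeta> n)"
    unfolding w_def using h by (intro sum_interior_le) auto
  finally show ?thesis
    using h by (simp add: grid_norm_power2 algebra_simps)
qed

text \<open>At the last level the maxima in the bound run over the whole mesh and hence bound the
  data at every level of the Gronwall argument.\<close>

lemma stability_at_last_level:
  assumes h: "0 < h" and M: "1 \<le> M" and N: "1 \<le> N"
    and \<rho>: "\<And>k. 1 \<le> k \<Longrightarrow> k < N \<Longrightarrow> tstep t k \<le> \<rho> * tstep t (k + 1)"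
    and small: "\<And>k. 1 \<le> k \<Longrightarrow> k \<le> N \<Longrightarrow> 4 * max q 0 * (Gamma (2 - \<alpha>) * tstep t k powr \<alpha>) \<le> 1"
    and u: "\<And>n. n \<in> {1..N} \<Longrightarrow> u n 0 = 0 \<and> u n M = 0"
    and eq_u: "\<And>n i. n \<in> {1..N} \<Longrightarrow> i \<in> {1..M - 1} \<Longrightarrow>
      avg M (\<lambda>j. L1_deriv \<alpha> t (\<lambda>k. u k j) n) i =
        - dxx h M (v n) i + q * avg M (u n) i + \<xi> n i + \<zeta> n i"
    and eq_v: "\<And>n i. n \<in> {1..N} \<Longrightarrow> i \<in> {0..M} \<Longrightarrow> avg M (v n) i = dxx h M (u n) i + \<eta> n i"
  shows "grid_norm h M (avg M (u N)) \<le> stability_bound \<alpha> q \<rho> h M t u \<xi> \<zeta> \<eta> N"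
proof -
  define w where "w k = interior_norm h M (avg M (u k))" for k
  define Z where "Z = (MAX k\<in>{1..N}. \<Sum>j = 1..k. P k j * grid_norm h M (\<zeta> j))"
  define X where "X = (MAX k\<in>{1..N}. t k powr \<alpha> * grid_norm h M (\<xi> k))"
  define H where "H = (MAX k\<in>{1..N}. t k powr (\<alpha> / 2) * grid_norm h M (\<eta> k))"
  define G where "G = sqrt (Gamma (1 - \<alpha>)) * H"
  define W where "W k = max (w k) G" for k
  define g where "g j = grid_norm h M (\<xi> j) + grid_norm h M (\<zeta> j) + 3 / 4 * (omega (1 - \<alpha>) (t j) * G)" for j
  \<comment> \<open>\<open>B\<close> bounds the complementary sums of \<open>g\<close>:
    \<open>sum_P_le\<close> handles the \<open>\<xi>\<close> and \<open>\<eta>\<close> parts, while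
    the \<open>\<zeta>\<close> part is kept as a sum.\<close>
  define B where "B = Gamma (1 - \<alpha>) * X + Z + 3 / 4 * G"
  have Gam: "0 < Gamma (1 - \<alpha>)" using \<alpha> by simp
  have gn: "0 \<le> grid_norm h M x" for x
    using h by (intro grid_norm_nonneg) auto
  have Z: "(\<Sum>j = 1..k. P k j * grid_norm h M (\<zeta> j)) \<le> Z"
    and X: "t k powr \<alpha> * grid_norm h M (\<xi> k) \<le> X"
    and H: "t k powr (\<alpha> / 2) * grid_norm h M (\<eta> k) \<le> H"
    if "1 \<le> k" "k \<le> N" for k
    unfolding Z_def X_def H_def using that by (auto intro!: Max_ge)
  have X0: "0 \<le> X" and H0: "0 \<le> H"
    using order_trans[OF _ X, of 0 1] order_trans[OF _ H, of 0 1] N gn by auto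
  have "0 \<le> P 1 1 * grid_norm h M (\<zeta> 1)"
    using N gn by (intro mult_nonneg_nonneg P_nonneg) auto
  then have Z0: "0 \<le> Z" using Z[of 1] N by simp
  have G0: "0 \<le> G" using Gam H0 by (simp add: G_def)
  have B0: "0 \<le> B" using Gam X0 Z0 G0 by (simp add: B_def)
  have w0: "0 \<le> w k" for k
    unfolding w_def using h by (intro interior_norm_nonneg) auto
  have "W N \<le> mittag_leffler \<alpha> (4 * max q 0 * max 1 \<rho> * t N powr \<alpha>) * (W 0 + B)"
  proof (rule discrete_gronwall[OF \<rho> _ small])
    fix n assume n: "1 \<le> n" "n \<le> N"
    have "w n * L1_deriv \<alpha> t w n \<le>
      max q 0 * (w n)\<^sup>2 + (grid_norm h M (\<xi> n) + grid_norm h M (\<zeta> n)) * w n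
      + 3 / 4 * (grid_norm h M (\<eta> n))\<^sup>2"
      unfolding w_def using n u[of n] eq_u[of n] eq_v[of n]
      by (intro energy_estimate[OF h M n, where v = v]) auto
    moreover have "sqrt (Gamma (1 - \<alpha>)) * (t n powr (\<alpha> / 2) * grid_norm h M (\<eta> n)) \<le> G"
      unfolding G_def using H[OF n] Gam by (intro mult_left_mono) auto
    ultimately show "L1_deriv \<alpha> t W n \<le> max q 0 * W n + g n"
      unfolding W_def g_def using gn by (intro L1_deriv_max_le n) auto
    have "(\<Sum>j = 1..n. P n j * grid_norm h M (\<xi> j)) \<le> Gamma (1 - \<alpha>) * X"
    proof (rule sum_P_le[OF n])
      show "0 \<le> Gamma (1 - \<alpha>) * X" using Gam X0 by simp
      fix j assume j: "1 \<le> j" "j \<le> n"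
      have "grid_norm h M (\<xi> j) =
          omega (1 - \<alpha>) (t j) * (Gamma (1 - \<alpha>) * t j powr \<alpha>) * grid_norm h M (\<xi> j)"
        using omega_Gamma_powr[of j] j n by simp
      also have "\<dots> = omega (1 - \<alpha>) (t j) * (Gamma (1 - \<alpha>) * (t j powr \<alpha> * grid_norm h M (\<xi> j)))"
        by (simp only: ac_simps)
      also have "\<dots> \<le> omega (1 - \<alpha>) (t j) * (Gamma (1 - \<alpha>) * X)"
        using X[of j] j n \<alpha> Gam by (intro mult_left_mono omega_nonneg) auto
      finally show "grid_norm h M (\<xi> j) \<le> omega (1 - \<alpha>) (t j) * (Gamma (1 - \<alpha>) * X)" .
    qed
    moreover have "(\<Sum>j = 1..n. P n j * (3 / 4 * (omega (1 - \<alpha>) (t j) * G))) \<le> 3 / 4 * G"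
      using G0 by (intro sum_P_le n) auto
    ultimately show "(\<Sum>j = 1..n. P n j * g j) \<le> B"
      unfolding g_def B_def distrib_left sum.distrib using Z[OF n] by linarith
  next
    show "0 \<le> W 0 + B" using B0 w0[of 0] by (simp add: W_def)
  qed (use N in auto)
  moreover define e where "e = mittag_leffler \<alpha> (4 * max q 0 * max 1 \<rho> * t N powr \<alpha>)"
  have "1 + (4 * max q 0 * max 1 \<rho> * t N powr \<alpha>) / Gamma (1 + \<alpha>) \<le> e"
    unfolding e_def using \<alpha> by (intro mittag_leffler_ge) auto
  moreover have "0 \<le> (4 * max q 0 * max 1 \<rho> * t N powr \<alpha>) / Gamma (1 + \<alpha>)"
    using \<alpha> by (intro divide_nonneg_pos Gamma_real_pos) auto
  ultimately have e: "0 \<le> e" "w N \<le> e * (W 0 + B)"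
    by (auto simp: W_def e_def)
  have "W 0 \<le> grid_norm h M (avg M (u 0)) + G"
    using interior_norm_le_grid_norm[of h M "avg M (u 0)"] h G0 gn[of "avg M (u 0)"]
    by (auto simp: W_def w_def)
  \<comment> \<open>One \<open>G\<close> comes from \<open>W 0\<close> and \<open>3 / 4 * G\<close>
    from \<open>B\<close>; the factor \<open>8 / 7\<close> turns their sum into
    \<open>2 * G\<close>.\<close>
  then have "8 / 7 * (W 0 + B) \<le> 8 / 7 * (grid_norm h M (avg M (u 0)) + 7 / 4 * G + Z + Gamma (1 - \<alpha>) * X)"
    by (simp add: B_def)
  also have "\<dots> \<le> 2 * (grid_norm h M (avg M (u 0)) + 2 * Z + 2 * (Gamma (1 - \<alpha>) * X) + G)"
    using gn[of "avg M (u 0)"] Z0 Gam X0 mult_nonneg_nonneg[of "Gamma (1 - \<alpha>)" X] by argo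
  finally have *: "8 / 7 * (W 0 + B) \<le>
      2 * (grid_norm h M (avg M (u 0)) + 2 * Z + 2 * (Gamma (1 - \<alpha>) * X) + G)" .
  have "grid_norm h M (avg M (u N)) \<le> 8 / 7 * w N"
    unfolding w_def using h M N u[of N] by (intro grid_norm_avg_le) auto
  also have "\<dots> \<le> 8 / 7 * (e * (W 0 + B))"
    using e by (intro mult_left_mono) auto
  also have "\<dots> = e * (8 / 7 * (W 0 + B))" by simp
  also have "\<dots> \<le> e * (2 * (grid_norm h M (avg M (u 0)) + 2 * Z + 2 * (Gamma (1 - \<alpha>) * X) + G))"
    using e(1) by (intro mult_left_mono *)
  also have "\<dots> = stability_bound \<alpha> q \<rho> h M t u \<xi> \<zeta> \<eta> N"
    unfolding stability_bound_def e_def Z_def X_def H_def G_def by (simp only: ac_simps)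
  finally show ?thesis .
qed

end

section \<open>Differences of solutions and the theorem\<close>

lemma L1_deriv_diff:
  "L1_deriv \<alpha> t (\<lambda>k. u k - v k) n = L1_deriv \<alpha> t u n - L1_deriv \<alpha> t v n"
  unfolding L1_deriv_def sum_subtractf[symmetric] by (intro sum.cong) (auto simp: algebra_simps)

lemma avg_diff: "avg M (\<lambda>i. u i - v i) i = avg M u i - avg M v i"
  by (simp add: avg_def algebra_simps diff_divide_distrib)

lemma dxx_diff: "dxx h M (\<lambda>i. u i - v i) i = dxx h M u i - dxx h M v i"
  by (simp add: dxx_def dx_def algebra_simps diff_divide_distrib add_divide_distrib)

lemma step_restriction:
  fixes q c s \<alpha> :: real
  assumes "0 < \<alpha>" "0 < c" "0 < s" "0 \<le> q" and s: "0 < q \<Longrightarrow> s \<le> 1 / (4 * c * q) powr (1 / \<alpha>)"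
  shows "4 * q * (c * s powr \<alpha>) \<le> 1"
proof (cases "q = 0")
  case False
  with assms have q: "0 < q" by simp
  have "s powr \<alpha> \<le> (1 / (4 * c * q) powr (1 / \<alpha>)) powr \<alpha>"
    using assms q by (intro powr_mono2) auto
  also have "\<dots> = 1 / (4 * c * q)"
    using assms q by (simp add: powr_divide powr_powr)
  finally show ?thesis
    using assms q by (simp add: field_simps)
qed simp

theorem theorem3p1:
  fixes \<alpha> L T q \<rho> h :: real and t :: "nat \<Rightarrow> real" and M N :: nat
  assumes "0 < \<alpha>" "\<alpha> < 1" "0 < L" "0 < T"
    and "t 0 = 0" "t N = T" "\<forall>k\<in>{1..N}. t (k - 1) < t k"
    and "0 < \<rho>" "\<forall>k\<in>{1..N - 1}. tstep t k / tstep t (k + 1) \<le> \<rho>"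
    and "0 < M" "h = L / real M"
    and "max q 0 > 0 \<longrightarrow>
      (MAX k\<in>{1..N}. tstep t k) \<le> 1 / (4 * Gamma (2 - \<alpha>) * max q 0) powr (1 / \<alpha>)"
  shows "(\<forall>u v \<xi> \<zeta> \<eta> :: nat \<Rightarrow> nat \<Rightarrow> real.
      (\<forall>n\<in>{1..N}. \<forall>i\<in>{1..M - 1}.
         avg M (\<lambda>j. L1_deriv \<alpha> t (\<lambda>k. u k j) n) i =
           - dxx h M (v n) i + q * avg M (u n) i + \<xi> n i + \<zeta> n i) \<and>
      (\<forall>n\<in>{0..N}. \<forall>i\<in>{0..M}. avg M (v n) i = dxx h M (u n) i + \<eta> n i) \<and>
      (\<forall>n\<in>{1..N}. u n 0 = 0 \<and> u n M = 0)
      \<longrightarrow> (\<forall>n\<in>{1..N}. grid_norm h M (avg M (u n)) \<le> stability_bound \<alpha> q \<rho> h M t u \<xi> \<zeta> \<eta> n)) \<and>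
    (\<forall>f g bl br \<phi> \<phi>' u v u' v' \<xi> \<zeta> \<eta>.
      compact_scheme \<alpha> q h M N t f g bl br \<phi> (\<lambda>n i. 0) (\<lambda>n i. 0) u v \<and>
      compact_scheme \<alpha> q h M N t f g bl br \<phi>' (\<lambda>n i. \<xi> n i + \<zeta> n i) \<eta> u' v'
      \<longrightarrow> (\<forall>n\<in>{1..N}.
         grid_norm h M (avg M (\<lambda>i. u' n i - u n i)) \<le>
           stability_bound \<alpha> q \<rho> h M t (\<lambda>n i. u' n i - u n i) \<xi> \<zeta> \<eta> n))"
proof -
  have perturbed: "grid_norm h M (avg M (u n)) \<le> stability_bound \<alpha> q \<rho> h M t u \<xi> \<zeta> \<eta> n"
    if eq_u: "\<And>n i. n \<in> {1..N} \<Longrightarrow> i \<in> {1..M - 1} \<Longrightarrow>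
        avg M (\<lambda>j. L1_deriv \<alpha> t (\<lambda>k. u k j) n) i =
          - dxx h M (v n) i + q * avg M (u n) i + \<xi> n i + \<zeta> n i"
      and eq_v: "\<And>n i. n \<in> {0..N} \<Longrightarrow> i \<in> {0..M} \<Longrightarrow> avg M (v n) i = dxx h M (u n) i + \<eta> n i"
      and u: "\<And>n. n \<in> {1..N} \<Longrightarrow> u n 0 = 0 \<and> u n M = 0"
      and n: "n \<in> {1..N}"
    for u v \<xi> \<zeta> \<eta> :: "nat \<Rightarrow> nat \<Rightarrow> real" and n
  proof -
    \<comment> \<open>The mesh is cut off at \<open>n\<close>, since the maxima in the bound reach
      only up to level \<open>n\<close>.\<close>
    interpret L1_mesh \<alpha> t n
      using assms n by unfold_locales auto
    show ?thesis
    proof (rule stability_at_last_level)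
      show "0 < h" using assms by simp
      show "1 \<le> M" using assms by simp
      show "1 \<le> n" using n by simp
      fix k
      show "tstep t k \<le> \<rho> * tstep t (k + 1)" if "1 \<le> k" "k < n"
      proof -
        have "tstep t k / tstep t (k + 1) \<le> \<rho>"
          using assms(9) that n by auto
        then show ?thesis
          using tstep_pos[of "k + 1"] that by (simp add: divide_le_eq)
      qed
      show "4 * max q 0 * (Gamma (2 - \<alpha>) * tstep t k powr \<alpha>) \<le> 1" if "1 \<le> k" "k \<le> n"
      proof (rule step_restriction)
        assume "0 < max q 0"
        have "tstep t k \<le> (MAX k\<in>{1..N}. tstep t k)"
          using that n by (intro Max_ge) auto
        also have "\<dots> \<le> 1 / (4 * Gamma (2 - \<alpha>) * max q 0) powr (1 / \<alpha>)"
          using assms(12) \<open>0 < max q 0\<close> by simp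
        finally show "tstep t k \<le> 1 / (4 * Gamma (2 - \<alpha>) * max q 0) powr (1 / \<alpha>)" .
      qed (use assms tstep_pos[of k] that in auto)
    next
      fix m assume "m \<in> {1..n}"
      then have m: "m \<in> {1..N}" using n by auto
      show "u m 0 = 0 \<and> u m M = 0" by (rule u[OF m])
      fix i
      show "avg M (\<lambda>j. L1_deriv \<alpha> t (\<lambda>k. u k j) m) i =
          - dxx h M (v m) i + q * avg M (u m) i + \<xi> m i + \<zeta> m i" if "i \<in> {1..M - 1}"
        by (rule eq_u[OF m that])
      show "avg M (v m) i = dxx h M (u m) i + \<eta> m i" if "i \<in> {0..M}"
        using eq_v[OF _ that, of m] m by auto
    qed
  qed
  show ?thesis
  proof (intro conjI allI impI ballI)
    fix u v \<xi> \<zeta> \<eta> :: "nat \<Rightarrow> nat \<Rightarrow> real" and n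
    assume "(\<forall>n\<in>{1..N}. \<forall>i\<in>{1..M - 1}.
         avg M (\<lambda>j. L1_deriv \<alpha> t (\<lambda>k. u k j) n) i =
           - dxx h M (v n) i + q * avg M (u n) i + \<xi> n i + \<zeta> n i) \<and>
      (\<forall>n\<in>{0..N}. \<forall>i\<in>{0..M}. avg M (v n) i = dxx h M (u n) i + \<eta> n i) \<and>
      (\<forall>n\<in>{1..N}. u n 0 = 0 \<and> u n M = 0)" and "n \<in> {1..N}"
    then show "grid_norm h M (avg M (u n)) \<le> stability_bound \<alpha> q \<rho> h M t u \<xi> \<zeta> \<eta> n"
      by (intro perturbed[where v = v]) blast+
  next
    fix f g bl br \<phi> \<phi>' u v u' v' \<xi> \<zeta> \<eta> n
    assume a: "compact_scheme \<alpha> q h M N t f g bl br \<phi> (\<lambda>n i. 0) (\<lambda>n i. 0) u v \<and>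
      compact_scheme \<alpha> q h M N t f g bl br \<phi>' (\<lambda>n i. \<xi> n i + \<zeta> n i) \<eta> u' v'" and n: "n \<in> {1..N}"
    show "grid_norm h M (avg M (\<lambda>i. u' n i - u n i)) \<le>
        stability_bound \<alpha> q \<rho> h M t (\<lambda>n i. u' n i - u n i) \<xi> \<zeta> \<eta> n"
    \<comment> \<open>By linearity \<open>f\<close>, \<open>g\<close> and the boundary values cancel
      in the difference. The initial values may differ, and their difference enters through
      \<open>u 0\<close> in the bound.\<close>
    proof (rule perturbed[where v = "\<lambda>n i. v' n i - v n i", OF _ _ _ n])
      fix n i assume ni: "n \<in> {1..N}" "i \<in> {1..M - 1}"
      have "avg M (\<lambda>j. L1_deriv \<alpha> t (\<lambda>k. u k j) n) i =
            - dxx h M (v n) i + q * avg M (u n) i + avg M (f n) i + 0"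
        "avg M (\<lambda>j. L1_deriv \<alpha> t (\<lambda>k. u' k j) n) i =
            - dxx h M (v' n) i + q * avg M (u' n) i + avg M (f n) i + (\<xi> n i + \<zeta> n i)"
        using a ni unfolding compact_scheme_def by blast+
      then show "avg M (\<lambda>j. L1_deriv \<alpha> t (\<lambda>k. u' k j - u k j) n) i =
          - dxx h M (\<lambda>i. v' n i - v n i) i + q * avg M (\<lambda>i. u' n i - u n i) i + \<xi> n i + \<zeta> n i"
        unfolding L1_deriv_diff avg_diff dxx_diff by (simp add: right_diff_distrib)
    qed (use a in \<open>auto simp: compact_scheme_def avg_diff dxx_diff\<close>)
  qed
qed

end
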